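(* Let $X,Y\in\mathcal{B}_A(\mathcal{H})$ and $\beta\ge 0$. Then for all $r\ge 1$, $$\omega_{\mathbb{A}}^{4r}\left(\begin{bmatrix} 0& X\\ Y& 0\end{bmatrix}\right)\le \frac{2\beta+1}{8(\beta+1)}\max\{\lambda_r^2,\mu_r^2\}+\frac{1}{2(\beta+1)}\max\{\omega_A^{2r}(XY),\omega_A^{2r}(YX)\},$$ where $\lambda_r=\|(Y^{\sharp_A}Y)^r+(XX^{\sharp_A})^r\|_A$ and $\mu_r=\|(YY^{\sharp_A})^r+(X^{\sharp_A}X)^r\|_A$.
   Context: $\mathcal{H}$ is a complex Hilbert space, $\mathcal{B}(\mathcal{H})$ the bounded linear operators on it, and $A\in\mathcal{B}(\mathcal{H})$ is a fixed positive (semidefinite) operator. Put $\langle x,y\rangle_A=\langle Ax,y\rangle$ and $\|x\|_A=\langle x,x\rangle_A^{1/2}$. $\mathcal{B}_A(\mathcal{H})$ is the set of $T\in\mathcal{B}(\mathcal{H})$ for which there is $S\in\mathcal{B}(\mathcal{H})$ with $AS=T^*A$; for such $T$, $T^{\sharp_A}=A^\dagger T^*A$ ($A^\dagger$ the Moore-Penrose inverse), i.e. the unique bounded solution $S$ of $AS=T^*A$ with range in $\overline{\mathrm{ran}(A)}$. The $A$-operator seminorm is $\|T\|_A=\sup\{\|Tx\|_A/\|x\|_A : x\in\overline{\mathrm{ran}(A)},\ x\ne 0\}$, and the $A$-numerical radius is $\omega_A(T)=\sup\{|\langle Tx,x\rangle_A| : x\in\mathcal{H},\ \|x\|_A=1\}$.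 On $\mathcal{H}\oplus\mathcal{H}$ let $\mathbb{A}=\begin{bmatrix}A&0\\0&A\end{bmatrix}$; $\omega_{\mathbb{A}}$ is defined as $\omega_A$ with $\mathbb{A}$ in place of $A$. $\omega_A^s(T)$ means $(\omega_A(T))^s$. Powers: an operator $S\in\mathcal{B}_A(\mathcal{H})$ is $A$-positive if $AS\ge 0$ (e.g. $T^{\sharp_A}T$ and $TT^{\sharp_A}$). Every $S\in\mathcal{B}_A(\mathcal{H})$ induces a bounded operator $\tilde S$ on the Hilbert space completion of $\mathcal{H}/\ker A$ under $\langle\cdot,\cdot\rangle_A$, with $\|\tilde S\|=\|S\|_A$, and $\tilde S\ge 0$ if $S$ is $A$-positive; for real $r>0$ and $A$-positive $S,R$, $\|S^r+R^r\|_A$ means $\|\tilde S^r+\tilde R^r\|$ (for integer $r$ this is the seminorm of the ordinary sum of powers). *)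

theory Defs
  imports "HOL-Analysis.Analysis" "HOL-Computational_Algebra.Polynomial"
    "HOL-Computational_Algebra.Formal_Power_Series"
begin

section \<open>Complex Hilbert spaces\<close>

text \<open>
  Complex scalar multiplication and the complex inner product (linear in the first argument)
  are added to the library's real inner product spaces, whose \<open>inner\<close> is the real part of
  \<open>cinner\<close>; the norm, the topology and completeness are those of the library.
\<close>

class complex_hilbert_space = real_inner + banach +
  fixes scaleC :: "complex \<Rightarrow> 'a \<Rightarrow> 'a"  (infixr \<open>*\<^sub>C\<close> 75)
    and cinner :: "'a \<Rightarrow> 'a \<Rightarrow> complex"
  assumes scaleC_add_right: "c *\<^sub>C (x + y) = c *\<^sub>C x + c *\<^sub>C y"
    and scaleC_add_left: "(c + d) *\<^sub>C x = c *\<^sub>C x + d *\<^sub>C x"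
    and scaleC_scaleC: "c *\<^sub>C d *\<^sub>C x = (c * d) *\<^sub>C x"
    and scaleR_scaleC: "scaleR t x = of_real t *\<^sub>C x"
    and cinner_commute: "cinner x y = cnj (cinner y x)"
    and cinner_add_left: "cinner (x + y) z = cinner x z + cinner y z"
    and cinner_scaleC_left: "cinner (c *\<^sub>C x) y = c * cinner x y"
    and inner_eq_Re_cinner: "inner x y = Re (cinner x y)"

instantiation complex :: complex_hilbert_space
begin

definition scaleC_complex :: "complex \<Rightarrow> complex \<Rightarrow> complex"
  where "scaleC_complex c x = c * x"

definition cinner_complex :: "complex \<Rightarrow> complex \<Rightarrow> complex"
  where "cinner_complex x y = x * cnj y"

instance
  by standard
     (simp_all add: scaleC_complex_def cinner_complex_def algebra_simps scaleR_conv_of_real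
        inner_complex_def)

end

instantiation prod :: (complex_hilbert_space, complex_hilbert_space) complex_hilbert_space
begin

definition scaleC_prod :: "complex \<Rightarrow> 'a \<times> 'b \<Rightarrow> 'a \<times> 'b"
  where "scaleC_prod c x = (c *\<^sub>C fst x, c *\<^sub>C snd x)"

definition cinner_prod :: "'a \<times> 'b \<Rightarrow> 'a \<times> 'b \<Rightarrow> complex"
  where "cinner_prod x y = cinner (fst x) (fst y) + cinner (snd x) (snd y)"

instance
proof
  fix x y :: "'a \<times> 'b"
  show "cinner x y = cnj (cinner y x)"
    using cinner_commute[of "fst x" "fst y"] cinner_commute[of "snd x" "snd y"]
    by (simp add: cinner_prod_def)
qed (simp_all add: scaleC_prod_def cinner_prod_def scaleC_add_right scaleC_add_left
      scaleC_scaleC scaleR_scaleC cinner_add_left cinner_scaleC_left inner_prod_def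
      inner_eq_Re_cinner prod_eq_iff distrib_left)

end


section \<open>Bounded operators\<close>

definition bounded_clinear :: "('a::complex_hilbert_space \<Rightarrow> 'b::complex_hilbert_space) \<Rightarrow> bool"
  where "bounded_clinear T \<longleftrightarrow> bounded_linear T \<and> (\<forall>c x. T (c *\<^sub>C x) = c *\<^sub>C T x)"

definition positive_op :: "('a::complex_hilbert_space \<Rightarrow> 'a) \<Rightarrow> bool"
  where "positive_op A \<longleftrightarrow> bounded_clinear A \<and> (\<forall>x. cinner (A x) x \<in> \<real>\<^sub>\<ge>\<^sub>0)"

definition cadjoint :: "('a::complex_hilbert_space \<Rightarrow> 'b::complex_hilbert_space) \<Rightarrow> 'b \<Rightarrow> 'a"
  where "cadjoint T = (THE S. bounded_clinear S \<and> (\<forall>x y. cinner (S y) x = cinner y (T x)))"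

definition block_op ::
  "('a::complex_hilbert_space \<Rightarrow> 'a) \<Rightarrow> ('a \<Rightarrow> 'a) \<Rightarrow> ('a \<Rightarrow> 'a) \<Rightarrow> ('a \<Rightarrow> 'a) \<Rightarrow> 'a \<times> 'a \<Rightarrow> 'a \<times> 'a"
  where "block_op P Q R S = (\<lambda>(x, y). (P x + Q y, R x + S y))"


section \<open>The semi-inner product induced by a positive operator\<close>

definition A_inner :: "('a::complex_hilbert_space \<Rightarrow> 'a) \<Rightarrow> 'a \<Rightarrow> 'a \<Rightarrow> complex"
  where "A_inner A x y = cinner (A x) y"

definition A_norm :: "('a::complex_hilbert_space \<Rightarrow> 'a) \<Rightarrow> 'a \<Rightarrow> real"
  where "A_norm A x = sqrt (Re (A_inner A x x))"

definition A_bounded_ops :: "('a::complex_hilbert_space \<Rightarrow> 'a) \<Rightarrow> ('a \<Rightarrow> 'a) set"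
  where "A_bounded_ops A =
    {T. bounded_clinear T \<and> (\<exists>S. bounded_clinear S \<and> A \<circ> S = cadjoint T \<circ> A)}"

definition A_sharp :: "('a::complex_hilbert_space \<Rightarrow> 'a) \<Rightarrow> ('a \<Rightarrow> 'a) \<Rightarrow> 'a \<Rightarrow> 'a"
  where "A_sharp A T =
    (THE S. bounded_clinear S \<and> A \<circ> S = cadjoint T \<circ> A \<and> range S \<subseteq> closure (range A))"

text \<open>
  The element \<open>0\<close> is inserted only to fix the supremum to be \<open>0\<close> when no vector has
  \<open>A\<close>-seminorm \<open>1\<close>, i.e. when \<open>A = 0\<close>.
\<close>

definition A_numerical_radius ::
  "('a::complex_hilbert_space \<Rightarrow> 'a) \<Rightarrow> ('a \<Rightarrow> 'a) \<Rightarrow> real"  (\<open>\<omega>\<close>)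
  where "\<omega> A T = Sup (insert 0 {cmod (A_inner A (T x) x) |x. A_norm A x = 1})"


section \<open>Operators on a closed subspace\<close>

text \<open>
  The operators below live on a closed subspace \<open>K\<close> of a Hilbert space; they are represented
  by functions on the whole type of which only the values on \<open>K\<close> matter.
\<close>

definition bounded_op_on :: "'k::complex_hilbert_space set \<Rightarrow> ('k \<Rightarrow> 'k) \<Rightarrow> bool"
  where "bounded_op_on K T \<longleftrightarrow>
    (\<forall>x\<in>K. T x \<in> K) \<and>
    (\<forall>x\<in>K. \<forall>y\<in>K. T (x + y) = T x + T y) \<and>
    (\<forall>c. \<forall>x\<in>K. T (c *\<^sub>C x) = c *\<^sub>C T x) \<and>
    (\<exists>M. \<forall>x\<in>K. norm (T x) \<le> M * norm x)"

definition onorm_on :: "'k::complex_hilbert_space set \<Rightarrow> ('k \<Rightarrow> 'k) \<Rightarrow> real"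
  where "onorm_on K T = (SUP x\<in>K. norm (T x) / norm x)"

definition spectrum_on :: "'k::complex_hilbert_space set \<Rightarrow> ('k \<Rightarrow> 'k) \<Rightarrow> complex set"
  where "spectrum_on K T =
    {z. \<not> (\<exists>R. bounded_op_on K R \<and>
           (\<forall>x\<in>K. R (T x - z *\<^sub>C x) = x \<and> T (R x) - z *\<^sub>C R x = x))}"

definition poly_op :: "complex poly \<Rightarrow> ('k::complex_hilbert_space \<Rightarrow> 'k) \<Rightarrow> 'k \<Rightarrow> 'k"
  where "poly_op p T x = (\<Sum>i\<le>degree p. coeff p i *\<^sub>C (T ^^ i) x)"

text \<open>
  Continuous functional calculus of a self-adjoint operator: \<open>f(T)\<close> is the norm limit of
  \<open>p\<^sub>n(T)\<close> for polynomials \<open>p\<^sub>n\<close> that converge to \<open>f\<close> uniformly on the spectrum of \<open>T\<close>.  For \<open>f\<close>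
  continuous on the (real, compact) spectrum such sequences exist and the limit does not depend
  on the sequence.
\<close>

definition fun_calc_on ::
  "'k::complex_hilbert_space set \<Rightarrow> ('k \<Rightarrow> 'k) \<Rightarrow> (complex \<Rightarrow> complex) \<Rightarrow> 'k \<Rightarrow> 'k"
  where "fun_calc_on K T f = (SOME P. bounded_op_on K P \<and>
    (\<forall>p. uniform_limit (spectrum_on K T) (\<lambda>n z. poly (p n) z) f sequentially \<longrightarrow>
         (\<lambda>n. onorm_on K (\<lambda>x. poly_op (p n) T x - P x)) \<longlonglongrightarrow> 0))"

definition rpower_on ::
  "'k::complex_hilbert_space set \<Rightarrow> ('k \<Rightarrow> 'k) \<Rightarrow> real \<Rightarrow> 'k \<Rightarrow> 'k"
  where "rpower_on K T r = fun_calc_on K T (\<lambda>z. z powr of_real r)"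


section \<open>The completion of the quotient by the kernel\<close>

text \<open>
  The completion of \<open>H / ker A\<close> with respect to the semi-inner product of \<open>A\<close> is given up to
  unitary equivalence by a linear map \<open>J\<close> from \<open>H\<close> into a Hilbert space that turns the
  semi-inner product into the inner product: then \<open>ker J = ker A\<close>, so \<open>J\<close> induces an isometric
  embedding of \<open>H / ker A\<close>, and the completion is \<open>closure (range J)\<close>.  The range of \<open>J\<close> need not
  be dense in the ambient type, so that a completion exists already with \<open>H\<close> itself as the
  ambient type (\<open>J\<close> the square root of \<open>A\<close>), see \<open>hilbert_completion_exists\<close> below.
\<close>

definition hilbert_completion ::
  "('a::complex_hilbert_space \<Rightarrow> 'a) \<Rightarrow> ('a \<Rightarrow> 'k::complex_hilbert_space) \<Rightarrow> bool"
  where "hilbert_completion A J \<longleftrightarrow>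
    (\<forall>x y. J (x + y) = J x + J y) \<and> (\<forall>c x. J (c *\<^sub>C x) = c *\<^sub>C J x) \<and>
    (\<forall>x y. cinner (J x) (J y) = A_inner A x y)"

definition induced_op ::
  "('a::complex_hilbert_space \<Rightarrow> 'k::complex_hilbert_space) \<Rightarrow> ('a \<Rightarrow> 'a) \<Rightarrow> 'k \<Rightarrow> 'k"
  where "induced_op J S =
    (SOME T. bounded_op_on (closure (range J)) T \<and> (\<forall>x. T (J x) = J (S x)))"

text \<open>The number \<open>\<parallel>S\<^sup>r + R\<^sup>r\<parallel>\<^sub>A\<close> for \<open>A\<close>-positive \<open>S\<close>, \<open>R\<close>.\<close>

definition power_sum_norm ::
  "('a::complex_hilbert_space \<Rightarrow> 'k::complex_hilbert_space) \<Rightarrow> real \<Rightarrow>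
   ('a \<Rightarrow> 'a) \<Rightarrow> ('a \<Rightarrow> 'a) \<Rightarrow> real"
  where "power_sum_norm J r S R = (let K = closure (range J) in
    onorm_on K (\<lambda>x. rpower_on K (induced_op J S) r x + rpower_on K (induced_op J R) r x))"


section \<open>Existence of a completion\<close>

text \<open>
  With \<open>A \<le> c\<close> and \<open>D = 1 - A/c\<close>, the binomial series of \<open>(1 - D)\<^sup>1\<^sup>/\<^sup>2\<close> yields the square root of
  \<open>A\<close> up to the factor \<open>sqrt c\<close>; its coefficients are absolutely summable.
\<close>

lemma cinner_add_right: "cinner x (y + z) = cinner x y + cinner (x::'a::complex_hilbert_space) z"
  by (metis cinner_add_left cinner_commute complex_cnj_add)

lemma cinner_scaleC_right: "cinner (x::'a::complex_hilbert_space) (c *\<^sub>C y) = cnj c * cinner x y"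
  by (metis cinner_scaleC_left cinner_commute complex_cnj_mult)

lemma positive_op_selfadjoint:
  assumes "positive_op A"
  shows "cinner (A x) y = cinner x (A y)"
proof -
  have add: "A (u + v) = A u + A v" and sc: "A (c *\<^sub>C u) = c *\<^sub>C A u" for u v c
    using assms by (auto simp: positive_op_def bounded_clinear_def linear_simps)
  have re: "Im (cinner (A u) u) = 0" for u
    using assms by (auto simp: positive_op_def complex_nonneg_Reals_iff)
  have 1: "Im (cinner (A x) y + cinner (A y) x) = 0"
    using re[of "x + y"] re[of x] re[of y]
    by (simp add: add cinner_add_left cinner_add_right)
  have 2: "Re (cinner (A y) x - cinner (A x) y) = 0"
    using re[of "x + \<i> *\<^sub>C y"] re[of x] re[of y]
    by (simp add: add sc cinner_add_left cinner_add_right cinner_scaleC_left cinner_scaleC_right)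
  have "cinner x (A y) = cnj (cinner (A y) x)"
    by (rule cinner_commute)
  with 1 2 show ?thesis
    by (simp add: complex_eq_iff)
qed

lemma gbinomial_half_bound:
  fixes a :: "nat \<Rightarrow> real"
  defines "a \<equiv> \<lambda>n. (-1)^n * ((1/2) gchoose n)"
  shows "summable (\<lambda>n. \<bar>a n\<bar>)"
proof -
  have m: "(-1)^n * ((-1/2 :: real) gchoose n) \<ge> 0" for n
  proof (induction n)
    case (Suc n)
    have "(-1/2 :: real) gchoose Suc n = ((-1/2) gchoose n) * (-1/2 - real n) / real (Suc n)"
      using gbinomial_rec[of "-1/2::real" n] gbinomial_absorb_comp[of "-1/2::real" n] 
      by (simp add: gbinomial_Suc_rec field_simps gbinomial_mult_1)
    moreover have "(-1/2 - real n) / real (Suc n) = - ((1/2 + real n) / real (Suc n))"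
      by (simp add: field_simps)
    ultimately have "(-1)^Suc n * ((-1/2 :: real) gchoose Suc n) =
        ((-1)^n * ((-1/2) gchoose n)) * ((1/2 + real n) / real (Suc n))"
      by (metis (no_types, opaque_lifting) mult.assoc mult_minus_left mult_minus_right
          power_Suc mult_1 times_divide_eq_right minus_minus)
    with Suc show ?case by simp
  qed simp
  have neg: "a (Suc n) \<le> 0" for n
  proof -
    have "(1/2 :: real) gchoose Suc n = (1/2) / real (Suc n) * ((-1/2) gchoose n)"
      using gbinomial_factors[of "-1/2 :: real" n] by simp
    then have "a (Suc n) = - ((1/2) / real (Suc n)) * ((-1)^n * ((-1/2) gchoose n))"
      by (simp add: a_def)
    then show ?thesis using m[of n] by (simp add: mult_nonneg_nonneg)
  qed
  have s: "(\<Sum>k\<le>n. a k) \<ge> 0" for n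
    using gbinomial_sum_lower_neg[of "1/2::real" n] m[of n] by (simp add: a_def mult.commute)
  have "(\<Sum>k\<le>n. \<bar>a (Suc k)\<bar>) \<le> 1" for n
  proof -
    have "(\<Sum>k\<le>n. \<bar>a (Suc k)\<bar>) = - (\<Sum>k\<le>n. a (Suc k))"
      using neg by (simp add: sum_negf[symmetric] abs_of_nonpos)
    also have "\<dots> = a 0 - (\<Sum>k\<le>Suc n. a k)"
      by (subst sum.atMost_Suc_shift) simp
    also have "\<dots> \<le> 1"
      using s[of "Suc n"] by (simp add: a_def del: sum.atMost_Suc)
    finally show ?thesis .
  qed
  then have "summable (\<lambda>n. \<bar>a (Suc n)\<bar>)"
    by (intro bounded_imp_summable[where B = 1]) auto
  then show ?thesis by (subst (asm) summable_Suc_iff)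
qed

lemma gbinomial_half_square:
  "(\<Sum>i\<le>n. ((-1)^i * ((1/2::real) gchoose i)) * ((-1)^(n-i) * ((1/2) gchoose (n-i))))
    = (if n = 0 then 1 else if n = 1 then -1 else 0)"
proof -
  have "(\<Sum>i\<le>n. ((-1)^i * ((1/2::real) gchoose i)) * ((-1)^(n-i) * ((1/2) gchoose (n-i)))) =
     (\<Sum>i\<le>n. (-1)^n * (((1/2::real) gchoose i) * ((1/2) gchoose (n-i))))"
    by (intro sum.cong refl) (simp add: power_add[symmetric] mult_ac)
  also have "\<dots> = (-1)^n * (1 gchoose n)"
    using gbinomial_Vandermonde[of "1/2::real" "1/2" n]
    by (simp add: sum_distrib_left[symmetric] atLeast0AtMost)
  also have "\<dots> = (if n = 0 then 1 else if n = 1 then -1 else 0)"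
  proof -
    have "(1::real) gchoose n = of_nat (1 choose n)"
      by (metis binomial_gbinomial of_nat_1)
    then show ?thesis by (cases n rule: nat.exhaust; cases "n-1") auto
  qed
  finally show ?thesis .
qed

lemma hilbert_completion_exists:
  fixes A :: "'a::complex_hilbert_space \<Rightarrow> 'a"
  assumes A: "positive_op A"
  shows "\<exists>J :: 'a \<Rightarrow> 'a. hilbert_completion A J"
proof -
  have bl: "bounded_linear A" and scA: "A (c *\<^sub>C u) = c *\<^sub>C A u" for c u
    using A by (auto simp: positive_op_def bounded_clinear_def)
  interpret A: bounded_linear A by (rule bl)
  obtain c where c: "c > 0" "\<And>x. norm (A x) \<le> norm x * c"
    using A.pos_bounded by blast
  have sa: "cinner (A x) y = cinner x (A y)" for x y
    by (rule positive_op_selfadjoint[OF A])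
  have sai: "inner (A x) y = inner x (A y)" for x y
    by (simp add: inner_eq_Re_cinner sa)
  have pos: "inner (A x) x \<ge> 0" for x
    using A by (auto simp: positive_op_def inner_eq_Re_cinner complex_nonneg_Reals_iff)
  have key: "(norm (A x))\<^sup>2 \<le> c * inner (A x) x" for x
  proof -
    have "0 \<le> inner (A (x - (1/c) *\<^sub>R A x)) (x - (1/c) *\<^sub>R A x)" by (rule pos)
    also have "\<dots> = inner (A x) x - 2 / c * (norm (A x))\<^sup>2 + inner (A (A x)) (A x) / c\<^sup>2"
      using sai[of "A x" x, symmetric] c(1)
      by (simp add: A.diff A.scaleR inner_diff_left inner_diff_right power2_norm_eq_inner
          power2_eq_square sai[of "A x" x] power2_norm_eq_inner[unfolded power2_eq_square] field_simps)
    also have "inner (A (A x)) (A x) \<le> c * (norm (A x))\<^sup>2"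
    proof -
      have "inner (A (A x)) (A x) \<le> norm (A (A x)) * norm (A x)" by (rule norm_cauchy_schwarz)
      also have "\<dots> \<le> (norm (A x) * c) * norm (A x)" by (intro mult_right_mono c) auto
      finally show ?thesis by (simp add: power2_eq_square mult_ac)
    qed
    finally have "0 \<le> inner (A x) x - 2 / c * (norm (A x))\<^sup>2 + c * (norm (A x))\<^sup>2 / c\<^sup>2"
      using c(1) by (simp add: divide_right_mono)
    then show ?thesis using c(1) by (simp add: field_simps power2_eq_square)
  qed
  define D where "D x = x - (1/c) *\<^sub>R A x" for x
  have Dbl: "bounded_linear D"
    unfolding D_def by (intro bounded_linear_intros bl bounded_linear_sub bounded_linear_ident
       bounded_linear_compose[OF bounded_linear_scaleR_right])
  interpret D: bounded_linear D by (rule Dbl)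
  have nD: "norm (D x) \<le> norm x" for x
  proof -
    have "(norm (D x))\<^sup>2 = (norm x)\<^sup>2 - 2 / c * inner (A x) x + (norm (A x))\<^sup>2 / c\<^sup>2"
      unfolding D_def power2_norm_eq_inner
      by (simp add: inner_diff_left inner_diff_right power2_eq_square
          inner_commute[of x "A x"] diff_divide_distrib)
    also have "\<dots> \<le> (norm x)\<^sup>2 - 2 / c * inner (A x) x + (c * inner (A x) x) / c\<^sup>2"
      using key[of x] c(1) by (simp add: divide_right_mono)
    also have "\<dots> = (norm x)\<^sup>2 - inner (A x) x / c"
      using c(1) by (simp add: field_simps power2_eq_square)
    also have "\<dots> \<le> (norm x)\<^sup>2" using pos[of x] c(1) by simp
    finally show ?thesis by (rule power2_le_imp_le) simp
  qed
  have Ddef2: "D u = u + complex_of_real (-1/c) *\<^sub>C A u" for u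
    by (simp only: D_def scaleR_scaleC[symmetric]) simp
  have scD: "D (z *\<^sub>C u) = z *\<^sub>C D u" for z u
    by (simp add: Ddef2 scA scaleC_add_right scaleC_scaleC mult.commute)
  have saD: "cinner (D x) y = cinner x (D y)" for x y
    by (simp add: Ddef2 cinner_add_left cinner_add_right cinner_scaleC_left cinner_scaleC_right sa)
  have nDn: "norm ((D ^^ n) x) \<le> norm x" for n x
    by (induction n) (auto intro: order_trans[OF nD])
  have addn: "(D ^^ n) (x + y) = (D ^^ n) x + (D ^^ n) y" for n x y
    by (induction n) (auto simp: D.add)
  have scn: "(D ^^ n) (z *\<^sub>C x) = z *\<^sub>C (D ^^ n) x" for n x z
    by (induction n) (auto simp: scD)
  have san: "cinner ((D ^^ n) x) y = cinner x ((D ^^ n) y)" for n x y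
    by (induction n arbitrary: x y) (auto simp: saD funpow_swap1)
  define a :: "nat \<Rightarrow> real" where "a n = (-1)^n * ((1/2) gchoose n)" for n
  have suma: "summable (\<lambda>n. \<bar>a n\<bar>)"
    using gbinomial_half_bound by (simp add: a_def)
  define B where "B x = (\<Sum>n. a n *\<^sub>R (D ^^ n) x)" for x
  have sumB: "(\<lambda>n. a n *\<^sub>R (D ^^ n) x) sums B x" for x
  proof -
    have "summable (\<lambda>n. a n *\<^sub>R (D ^^ n) x)"
      by (rule summable_comparison_test'[where g = "\<lambda>n. \<bar>a n\<bar> * norm x" and N = 0])
         (auto intro!: summable_mult2 suma mult_left_mono nDn)
    then show ?thesis unfolding B_def by (rule summable_sums)
  qed
  have addB: "B (x + y) = B x + B y" for x y
    using sums_add[OF sumB[of x] sumB[of y]] sumB[of "x + y"]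
    by (simp add: addn scaleR_add_right sums_unique2)
  have nsc: "norm (z *\<^sub>C u) = cmod z * norm u" for z and u :: 'a
  proof -
    have "cinner (z *\<^sub>C u) (z *\<^sub>C u) = of_real ((cmod z)\<^sup>2) * cinner u u"
      by (simp add: cinner_scaleC_left cinner_scaleC_right complex_norm_square mult_ac
          del: of_real_power)
    then have "inner (z *\<^sub>C u) (z *\<^sub>C u) = (cmod z)\<^sup>2 * inner u u"
      by (simp add: inner_eq_Re_cinner)
    then show ?thesis by (simp add: norm_eq_sqrt_inner real_sqrt_mult)
  qed
  have blC: "bounded_linear (\<lambda>u::'a. z *\<^sub>C u)" for z
    by (rule bounded_linear_intro[where K = "cmod z"])
       (auto simp: scaleC_add_right scaleR_scaleC scaleC_scaleC nsc mult.commute)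
  have scB: "B (z *\<^sub>C x) = z *\<^sub>C B x" for z x
  proof -
    have "(\<lambda>n. a n *\<^sub>R (D ^^ n) (z *\<^sub>C x)) sums (z *\<^sub>C B x)"
      using bounded_linear.sums[OF blC[of z] sumB[of x]]
      by (simp add: scn scaleR_scaleC scaleC_scaleC mult.commute)
    then show ?thesis using sumB sums_unique2 by blast
  qed
  have scr: "t *\<^sub>R u = of_real t *\<^sub>C u" for t and u :: 'a
    by (rule scaleR_scaleC)
  have cs: "cmod (cinner u v) \<le> norm u * norm v" for u v :: 'a
  proof (cases "cinner u v = 0")
    case False
    define z where "z = cnj (cinner u v) / cmod (cinner u v)"
    have "cinner (z *\<^sub>C u) v = of_real (cmod (cinner u v))"
    proof -
      have "cinner (z *\<^sub>C u) v = (cinner u v * cnj (cinner u v)) / of_real (cmod (cinner u v))"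
        by (simp add: z_def cinner_scaleC_left mult.commute)
      also have "\<dots> = of_real ((cmod (cinner u v))\<^sup>2) / of_real (cmod (cinner u v))"
        by (simp only: complex_norm_square)
      finally show ?thesis using False by (simp add: power2_eq_square)
    qed
    then have "cmod (cinner u v) = inner (z *\<^sub>C u) v" by (simp add: inner_eq_Re_cinner)
    also have "\<dots> \<le> norm (z *\<^sub>C u) * norm v" by (rule norm_cauchy_schwarz)
    also have "norm (z *\<^sub>C u) = norm u" using False by (simp add: nsc z_def norm_divide)
    finally show ?thesis .
  qed simp
  have bL: "bounded_linear (\<lambda>u. cinner u v)" for v :: 'a
    by (rule bounded_linear_intro[where K = "norm v"])
       (auto simp: cinner_add_left scr cinner_scaleC_left cs scaleR_conv_of_real)
  have bR: "bounded_linear (\<lambda>v. cinner u v)" for u :: 'a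
    by (rule bounded_linear_intro[where K = "norm u"])
       (auto simp: cinner_add_right scr cinner_scaleC_right scaleR_conv_of_real
          order_trans[OF cs] mult.commute)
  have DD: "cinner ((D ^^ n) x) ((D ^^ m) y) = cinner ((D ^^ (n + m)) x) y" for n m x y
    by (simp add: san[symmetric] add.commute[of n m] funpow_add)
  have BB: "cinner (B x) (B y) = cinner x y - cinner (D x) y" for x y
  proof -
    define g where "g k = cinner ((D ^^ k) x) y" for k
    have gb: "cmod (g k) \<le> norm x * norm y" for k
      unfolding g_def by (rule order_trans[OF cs]) (intro mult_right_mono nDn norm_ge_zero)
    define f where "f = (\<lambda>(n, m). of_real (a n * a m) * g (n + m))"
    define l where "l = (\<Sum>n. \<bar>a n\<bar>)"
    have ha: "((\<lambda>n. \<bar>a n\<bar>) has_sum l) UNIV"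
      unfolding l_def by (rule norm_summable_imp_has_sum) (use suma in \<open>auto intro: summable_sums\<close>)
    have "(\<lambda>(n, m). \<bar>a n\<bar> * (\<bar>a m\<bar> * (norm x * norm y))) summable_on (UNIV \<times> UNIV)"
    proof (rule summable_on_SigmaI)
      fix n :: nat
      show "((\<lambda>m. case (n, m) of (n, m) \<Rightarrow> \<bar>a n\<bar> * (\<bar>a m\<bar> * (norm x * norm y)))
          has_sum \<bar>a n\<bar> * (l * (norm x * norm y))) UNIV"
        using has_sum_cmult_right[OF has_sum_cmult_left[OF ha, of "norm x * norm y"], of "\<bar>a n\<bar>"] by simp
      show "(\<lambda>n. \<bar>a n\<bar> * (l * (norm x * norm y))) summable_on UNIV"
        by (intro summable_on_cmult_left has_sum_imp_summable[OF ha])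
    qed auto
    then have fs: "(\<lambda>p. norm (f p)) summable_on (UNIV \<times> UNIV)"
    proof (rule Infinite_Sum.abs_summable_on_comparison_test')
      fix p :: "nat \<times> nat"
      show "norm (f p) \<le> (case p of (n, m) \<Rightarrow> \<bar>a n\<bar> * (\<bar>a m\<bar> * (norm x * norm y)))"
        by (cases p) (auto simp: f_def norm_mult mult.assoc abs_mult intro!: mult_left_mono gb)
    qed
    then have fs': "f summable_on (UNIV \<times> UNIV)" by (rule Infinite_Sum.abs_summable_summable)
    have hs: "(h has_sum l) UNIV" if "h sums l" "summable (\<lambda>n. norm (h n))" for h :: "nat \<Rightarrow> complex" and l
      using that norm_summable_imp_has_sum by blast
    have inn: "((\<lambda>m. f (n, m)) has_sum (of_real (a n) * cinner ((D ^^ n) x) (B y))) UNIV" for n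
    proof (rule hs)
      show "(\<lambda>m. f (n, m)) sums (of_real (a n) * cinner ((D ^^ n) x) (B y))"
        using sums_mult[OF bounded_linear.sums[OF bR sumB[of y], of "(D ^^ n) x"], of "of_real (a n)"]
        by (simp add: scr cinner_scaleC_right DD f_def g_def mult_ac)
      show "summable (\<lambda>m. norm (f (n, m)))"
        by (rule summable_comparison_test'[where g = "\<lambda>m. \<bar>a m\<bar> * (\<bar>a n\<bar> * (norm x * norm y))" and N = 0])
           (auto intro!: summable_mult2 suma mult_left_mono[OF gb] mult_left_mono simp: f_def norm_mult abs_mult
              mult.left_commute[of "\<bar>a n\<bar>" "\<bar>a _\<bar>"] mult.assoc)
    qed
    have out: "((\<lambda>n. of_real (a n) * cinner ((D ^^ n) x) (B y)) has_sum cinner (B x) (B y)) UNIV"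
    proof (rule hs)
      show "(\<lambda>n. of_real (a n) * cinner ((D ^^ n) x) (B y)) sums cinner (B x) (B y)"
        using bounded_linear.sums[OF bL sumB[of x], of "B y"]
        by (simp add: scr cinner_scaleC_left)
      show "summable (\<lambda>n. norm (of_real (a n) * cinner ((D ^^ n) x) (B y)))"
        by (rule summable_comparison_test'[where g = "\<lambda>n. \<bar>a n\<bar> * (norm x * norm (B y))" and N = 0])
           (auto intro!: summable_mult2 suma mult_left_mono order_trans[OF cs] mult_right_mono nDn simp: norm_mult)
    qed
    have fh: "(f has_sum cinner (B x) (B y)) (UNIV \<times> UNIV)"
      by (rule has_sum_SigmaI[OF inn out fs'])
    have bij: "bij_betw (\<lambda>(k, i). (i, k - i)) (SIGMA k:UNIV. {..k}) (UNIV \<times> (UNIV::nat set))"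
      by (rule bij_betwI[where g = "\<lambda>(n, m). (n + m, n)"]) auto
    have "((\<lambda>(k, i). f (i, k - i)) has_sum cinner (B x) (B y)) (SIGMA k:UNIV. {..k})"
      using has_sum_reindex_bij_betw[OF bij, of f] fh by (simp add: case_prod_unfold)
    then have "((\<lambda>k. \<Sum>i\<le>k. f (i, k - i)) has_sum cinner (B x) (B y)) UNIV"
      by (rule has_sum_SigmaD) auto
    moreover have "(\<Sum>i\<le>k. f (i, k - i)) = (if k = 0 then g 0 else if k = 1 then - g 1 else 0)" for k
    proof -
      have "(\<Sum>i\<le>k. f (i, k - i)) = of_real (\<Sum>i\<le>k. a i * a (k - i)) * g k"
        by (simp add: f_def sum_distrib_right)
      then show ?thesis using gbinomial_half_square[of k] by (simp add: a_def)
    qed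
    ultimately have "((\<lambda>k::nat. if k = 0 then g 0 else if k = 1 then - g 1 else 0)
        has_sum cinner (B x) (B y)) UNIV" by simp
    moreover have "((\<lambda>k::nat. if k = 0 then g 0 else if k = 1 then - g 1 else 0)
        has_sum (g 0 - g 1)) UNIV"
      using has_sum_finite[of "{0, 1::nat}" "\<lambda>k. if k = 0 then g 0 else if k = 1 then - g 1 else 0"]
      by (subst has_sum_cong_neutral[where T = "{0, 1::nat}"]) auto
    ultimately have "cinner (B x) (B y) = g 0 - g 1" by (rule has_sum_unique)
    then show ?thesis by (simp add: g_def)
  qed
  have BA: "cinner (B x) (B y) = of_real (1 / c) * cinner (A x) y" for x y
    by (simp add: BB Ddef2 cinner_add_left cinner_scaleC_left)
  have "hilbert_completion A (\<lambda>x. of_real (sqrt c) *\<^sub>C B x)"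
    using c(1)
    by (auto simp: hilbert_completion_def A_inner_def addB scB scaleC_add_right scaleC_scaleC
        mult.commute cinner_scaleC_left cinner_scaleC_right BA mult.assoc[symmetric]
        simp flip: of_real_mult)
  then show ?thesis by blast
qed

end

theory Submission
  imports Defs "HOL-Computational_Algebra.Fundamental_Theorem_Algebra"
begin

text \<open>
  For a unit vector \<open>h\<close> of the completed direct sum and the block operator \<open>Z\<close>, put
  \<open>u = Z h\<close>, \<open>v = Z\<^sup>* h\<close>, \<open>m = \<bar>\<langle>Z h, h\<rangle>\<bar>\<close>.  Buzano's inequality gives \<open>2 m\<^sup>2 \<le> \<parallel>u\<parallel> \<parallel>v\<parallel> + \<bar>\<langle>Z\<^sup>2 h, h\<rangle>\<bar>\<close>
  and Cauchy--Schwarz gives \<open>m\<^sup>2 \<le> \<parallel>u\<parallel> \<parallel>v\<parallel>\<close>; after raising both to the power \<open>2 r\<close> by convexity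
  they are averaged with weights \<open>1 / (\<beta> + 1)\<close> and \<open>\<beta> / (\<beta> + 1)\<close>.  Since \<open>Z\<^sup>2\<close>, \<open>Z\<^sup>* Z\<close> and
  \<open>Z Z\<^sup>*\<close> are block diagonal, \<open>\<bar>\<langle>Z\<^sup>2 h, h\<rangle>\<bar>\<close> is controlled by the numerical radii of \<open>X Y\<close> and \<open>Y X\<close>, and
  \<open>2 \<parallel>u\<parallel>\<^sup>r \<parallel>v\<parallel>\<^sup>r \<le> \<parallel>u\<parallel>\<^sup>2\<^sup>r + \<parallel>v\<parallel>\<^sup>2\<^sup>r\<close> by \<open>max \<lambda>\<^sub>r \<mu>\<^sub>r\<close> through McCarthy's inequality.
  The powers are well defined because \<open>\<parallel>p(T)\<parallel>\<close> is bounded by \<open>\<bar>p\<bar>\<close> on the spectrum of a positive \<open>T\<close>.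
\<close>


section \<open>Complex inner products\<close>

text \<open>\<open>cadjoint\<close> and \<open>A_sharp\<close> are definite descriptions,
  \<open>fun_calc_on\<close> and \<open>induced_op\<close> are choices, so each defining property
  must be shown to be satisfiable before the object can be used; most of the work goes there. The
  obstacles are two. A member of \<open>A_bounded_ops A\<close> is bounded for the ordinary norm,
  whereas extension to the completion asks for boundedness in the seminorm; this is extracted from
  the mere existence of an \<open>A\<close>-adjoint. And the bound on \<open>p(T)\<close> is
  obtained without a spectral measure: for positive operators invertibility is the same as
  coercivity, and the fundamental theorem of algebra passes invertibility from the factors
  \<open>T - z\<close> to \<open>p(T)\<close>. Even operator inequalities such as McCarthy's are
  drawn from this norm bound. The constants: the weighted average puts (2\<beta> + 1) / (2(\<beta> +
  1)) in front of \<open>(norm u * norm v) powr (2 * r)\<close>, and the arithmetic-geometric mean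
  inequality contributes a further 1/4, whence the 8 in the denominator.\<close>

lemma cinner_zero_left [simp]: "cinner 0 (y::'a::complex_hilbert_space) = 0"
  using cinner_add_left[of 0 0 y] by simp

lemma cinner_zero_right [simp]: "cinner (x::'a::complex_hilbert_space) 0 = 0"
  using cinner_add_right[of x 0 0] by simp

lemma scaleC_one [simp]: "1 *\<^sub>C x = (x::'a::complex_hilbert_space)"
  using scaleR_scaleC[of 1 x] by simp

lemma scaleC_minus_one: "(-1) *\<^sub>C x = - (x::'a::complex_hilbert_space)"
  using scaleR_scaleC[of "-1" x] by simp

lemma scaleC_zero_left [simp]: "0 *\<^sub>C x = (0::'a::complex_hilbert_space)"
  using scaleR_scaleC[of 0 x] by simp

lemma scaleC_zero_right [simp]: "c *\<^sub>C 0 = (0::'a::complex_hilbert_space)"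
  using scaleC_add_right[of c 0 "0::'a"] by simp

lemma scaleC_minus_left: "(- c) *\<^sub>C x = - (c *\<^sub>C (x::'a::complex_hilbert_space))"
  by (metis mult_minus1 scaleC_minus_one scaleC_scaleC)

lemma cinner_minus_left: "cinner (- x) y = - cinner x (y::'a::complex_hilbert_space)"
  using cinner_scaleC_left[of "-1" x y] by (simp add: scaleC_minus_one)

lemma cinner_minus_right: "cinner x (- y) = - cinner x (y::'a::complex_hilbert_space)"
  using cinner_scaleC_right[of x "-1" y] by (simp add: scaleC_minus_one)

lemma cinner_diff_left: "cinner (x - y) z = cinner x z - cinner y (z::'a::complex_hilbert_space)"
  by (metis cinner_add_left cinner_minus_left uminus_add_conv_diff add.commute)

lemma cinner_diff_right: "cinner x (y - z) = cinner x y - cinner x (z::'a::complex_hilbert_space)"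
  by (metis cinner_add_right cinner_minus_right uminus_add_conv_diff add.commute)

lemmas cinner_simps = cinner_add_left cinner_add_right cinner_diff_left cinner_diff_right
  cinner_scaleC_left cinner_scaleC_right cinner_minus_left cinner_minus_right

lemma cinner_self: "cinner x (x::'a::complex_hilbert_space) = of_real ((norm x)\<^sup>2)"
proof -
  have "Im (cinner x x) = 0"
    using arg_cong[OF cinner_commute[of x x], of Im] by simp
  then show ?thesis
    by (simp add: complex_eq_iff power2_norm_eq_inner inner_eq_Re_cinner)
qed

lemma Re_cinner_self: "Re (cinner x (x::'a::complex_hilbert_space)) = (norm x)\<^sup>2"
  by (simp add: cinner_self)

lemma norm_scaleC: "norm (c *\<^sub>C (x::'a::complex_hilbert_space)) = cmod c * norm x"
proof -
  have "of_real ((norm (c *\<^sub>C x))\<^sup>2) = complex_of_real ((cmod c * norm x)\<^sup>2)"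
    unfolding cinner_self[symmetric] cinner_simps
    by (simp only: cinner_self) (simp only: complex_norm_square power_mult_distrib of_real_mult mult_ac)
  then show ?thesis
    by (metis norm_ge_zero of_real_eq_iff power2_eq_iff_nonneg zero_le_mult_iff)
qed

text \<open>Multiplying \<open>x\<close> by a phase makes the inner product real and nonnegative,
  and the Cauchy-Schwarz inequality of the underlying real space applies.\<close>

lemma cmod_cinner_le: "cmod (cinner x y) \<le> norm x * norm (y::'a::complex_hilbert_space)"
proof (cases "cinner x y = 0")
  case False
  define z where "z = cnj (cinner x y) / cmod (cinner x y)"
  have z: "cmod z = 1" using False by (simp add: z_def norm_divide)
  have "cinner (z *\<^sub>C x) y = of_real (cmod (cinner x y))"
    using False complex_norm_square[of "cinner x y"]
    by (simp add: z_def cinner_scaleC_left power2_eq_square mult.commute divide_eq_eq)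
  then have "cmod (cinner x y) = inner (z *\<^sub>C x) y"
    by (simp add: inner_eq_Re_cinner)
  also have "\<dots> \<le> norm (z *\<^sub>C x) * norm y"
    by (rule norm_cauchy_schwarz)
  finally show ?thesis by (simp add: norm_scaleC z)
qed simp

lemma Re_cinner_le: "Re (cinner x y) \<le> norm x * norm (y::'a::complex_hilbert_space)"
  using complex_Re_le_cmod[of "cinner x y"] cmod_cinner_le[of x y] by linarith

lemma norm_diff_squared:
  "(norm (x - y))\<^sup>2 = (norm x)\<^sup>2 - 2 * Re (cinner x y) + (norm (y::'a::complex_hilbert_space))\<^sup>2"
proof -
  have "Re (cinner y x) = Re (cinner x y)"
    by (subst cinner_commute) simp
  then show ?thesis
    unfolding Re_cinner_self[symmetric] by (simp add: cinner_simps)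
qed

text \<open>Cauchy--Schwarz is applied to \<open>y\<close> and the reflection \<open>2\<langle>x, e\<rangle>e - x\<close>, which has the norm of \<open>x\<close>.\<close>

lemma Buzano:
  fixes x y e :: "'a::complex_hilbert_space"
  assumes "norm e = 1"
  shows "cmod (cinner x e * cinner e y) \<le> (norm x * norm y + cmod (cinner x y)) / 2"
proof -
  define w where "w = (2 * cinner x e) *\<^sub>C e - x"
  have "cinner w w = cinner x x"
    using cinner_commute[of e x] by (simp add: w_def cinner_simps cinner_self[of e] assms)
  then have "norm w = norm x"
    by (metis Re_cinner_self norm_ge_zero power2_eq_iff_nonneg)
  then have "cmod (cinner w y) \<le> norm x * norm y"
    using cmod_cinner_le[of w y] by simp
  moreover have "2 * (cinner x e * cinner e y) = cinner w y + cinner x y"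
    by (simp add: w_def cinner_simps)
  then have "2 * cmod (cinner x e * cinner e y) \<le> cmod (cinner w y) + cmod (cinner x y)"
    by (metis norm_mult norm_numeral norm_triangle_ineq)
  ultimately show ?thesis by simp
qed

section \<open>Bounded complex-linear maps\<close>

lemma bounded_clinearI:
  assumes "\<And>x y. T (x + y) = T x + T y" "\<And>c x. T (c *\<^sub>C x) = c *\<^sub>C T x"
    "\<And>x. norm (T x) \<le> norm x * M"
  shows "bounded_clinear T"
  unfolding bounded_clinear_def using assms
  by (auto intro!: bounded_linear_intro[where K = M] simp: scaleR_scaleC)

lemma bounded_clinear_add: "bounded_clinear T \<Longrightarrow> T (x + y) = T x + T y"
  by (simp add: bounded_clinear_def linear_simps)

lemma bounded_clinear_diff: "bounded_clinear T \<Longrightarrow> T (x - y) = T x - T y"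
  by (simp add: bounded_clinear_def linear_simps)

lemma bounded_clinear_zero: "bounded_clinear T \<Longrightarrow> T 0 = 0"
  by (simp add: bounded_clinear_def linear_simps)

lemma bounded_clinear_scaleC: "bounded_clinear T \<Longrightarrow> T (c *\<^sub>C x) = c *\<^sub>C T x"
  by (simp add: bounded_clinear_def)

lemma bounded_clinear_pos_bound:
  assumes "bounded_clinear T"
  obtains M where "M > 0" "\<And>x. norm (T x) \<le> norm x * M"
  using assms bounded_linear.pos_bounded unfolding bounded_clinear_def by blast

lemma bounded_clinear_comp:
  assumes "bounded_clinear S" "bounded_clinear T"
  shows "bounded_clinear (S \<circ> T)"
  using assms bounded_linear_compose[of S T] by (auto simp: bounded_clinear_def o_def)

lemma tendsto_cinner [tendsto_intros]:
  fixes f g :: "'b \<Rightarrow> 'a::complex_hilbert_space"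
  assumes "(f \<longlongrightarrow> x) F" "(g \<longlongrightarrow> y) F"
  shows "((\<lambda>n. cinner (f n) (g n)) \<longlongrightarrow> cinner x y) F"
proof -
  have "bounded_bilinear (cinner :: 'a \<Rightarrow> 'a \<Rightarrow> complex)"
  proof
    show "\<exists>K. \<forall>a b. norm (cinner a (b::'a)) \<le> norm a * norm b * K"
      using cmod_cinner_le by (intro exI[of _ 1]) auto
  qed (auto simp: cinner_add_left cinner_add_right scaleR_scaleC[where 'a = 'a] cinner_scaleC_left
      cinner_scaleC_right scaleR_conv_of_real)
  then show ?thesis using assms by (rule bounded_bilinear.tendsto)
qed

lemma bounded_linear_scaleC: "bounded_linear (\<lambda>x::'a::complex_hilbert_space. c *\<^sub>C x)"
  by (rule bounded_linear_intro[where K = "cmod c"])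
     (auto simp: scaleC_add_right scaleR_scaleC scaleC_scaleC norm_scaleC mult.commute)


section \<open>Projections and adjoints\<close>

definition csubspace :: "'a::complex_hilbert_space set \<Rightarrow> bool"
  where "csubspace V \<longleftrightarrow>
    0 \<in> V \<and> (\<forall>x\<in>V. \<forall>y\<in>V. x + y \<in> V) \<and> (\<forall>c. \<forall>x\<in>V. c *\<^sub>C x \<in> V)"

lemma csubspace_diff: "csubspace V \<Longrightarrow> x \<in> V \<Longrightarrow> y \<in> V \<Longrightarrow> x - y \<in> V"
  unfolding csubspace_def by (metis scaleC_minus_one diff_conv_add_uminus)

lemma csubspace_closure:
  assumes "csubspace V"
  shows "csubspace (closure V)"
  unfolding csubspace_def
proof (intro conjI ballI allI)
  show "0 \<in> closure V"
    using assms closure_subset unfolding csubspace_def by blast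
next
  fix x y assume "x \<in> closure V" "y \<in> closure V"
  then obtain f g where "\<And>n. f n \<in> V" "f \<longlonglongrightarrow> x" "\<And>n. g n \<in> V" "g \<longlonglongrightarrow> y"
    unfolding closure_sequential by metis
  then have "\<And>n. f n + g n \<in> V" "(\<lambda>n. f n + g n) \<longlonglongrightarrow> x + y"
    using assms by (auto intro: tendsto_add simp: csubspace_def)
  then show "x + y \<in> closure V"
    unfolding closure_sequential by metis
next
  fix c x assume "x \<in> closure V"
  then obtain f where "\<And>n. f n \<in> V" "f \<longlonglongrightarrow> x"
    unfolding closure_sequential by metis
  then have "\<And>n. c *\<^sub>C f n \<in> V" "(\<lambda>n. c *\<^sub>C f n) \<longlonglongrightarrow> c *\<^sub>C x"
    using assms bounded_linear.tendsto[OF bounded_linear_scaleC] by (auto simp: csubspace_def)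
  then show "c *\<^sub>C x \<in> closure V"
    unfolding closure_sequential by metis
qed

lemma csubspace_range:
  fixes f :: "'a::complex_hilbert_space \<Rightarrow> 'b::complex_hilbert_space"
  assumes add: "\<And>x y. f (x + y) = f x + f y" and scale: "\<And>c x. f (c *\<^sub>C x) = c *\<^sub>C f x"
  shows "csubspace (range f)"
  unfolding csubspace_def
proof (intro conjI ballI allI)
  show "0 \<in> range f"
    using scale[of 0 0] by (intro range_eqI[of _ _ 0]) simp
  show "x + y \<in> range f" if "x \<in> range f" "y \<in> range f" for x y
  proof -
    from that obtain u v where "x = f u" "y = f v" by blast
    then show ?thesis by (intro range_eqI[of _ _ "u + v"]) (simp add: add)
  qed
  show "c *\<^sub>C x \<in> range f" if "x \<in> range f" for c x
  proof -
    from that obtain u where "x = f u" by blast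
    then show ?thesis by (intro range_eqI[of _ _ "c *\<^sub>C u"]) (simp add: scale)
  qed
qed

lemma closure_range_sequence:
  fixes f :: "'a \<Rightarrow> 'b::metric_space"
  assumes "k \<in> closure (range f)"
  obtains a where "(\<lambda>n. f (a n)) \<longlonglongrightarrow> k"
proof -
  from assms obtain g where g: "\<And>n. g n \<in> range f" "g \<longlonglongrightarrow> k"
    unfolding closure_sequential by blast
  then have "\<forall>n. \<exists>a. g n = f a" by blast
  then obtain a where "\<And>n. g n = f (a n)" by metis
  then have "g = (\<lambda>n. f (a n))" by blast
  then show thesis using g(2) that by blast
qed

text \<open>A minimizing sequence is Cauchy by the parallelogram law: the midpoint \<open>h\<close>
  of two of its members stays in \<open>V\<close>, so its squared distance from \<open>x\<close> is
  at least the infimum \<open>d\<close>, which forces the members together.\<close>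

lemma nearest_point_exists:
  fixes V :: "'a::complex_hilbert_space set"
  assumes V: "csubspace V" "closed V"
  shows "\<exists>p\<in>V. \<forall>m\<in>V. norm (x - p) \<le> norm (x - m)"
proof -
  define d where "d = Inf ((\<lambda>m. (norm (x - m))\<^sup>2) ` V)"
  have ne: "V \<noteq> {}" using V by (auto simp: csubspace_def)
  have bdd: "bdd_below ((\<lambda>m. (norm (x - m))\<^sup>2) ` V)"
    by (rule bdd_belowI[where m = 0]) auto
  have d_le: "d \<le> (norm (x - m))\<^sup>2" if "m \<in> V" for m
    unfolding d_def using bdd that by (intro cInf_lower) auto
  have "\<exists>m\<in>V. (norm (x - m))\<^sup>2 < d + inverse (real (Suc n))" for n
  proof -
    have "Inf ((\<lambda>m. (norm (x - m))\<^sup>2) ` V) < d + inverse (real (Suc n))"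
      by (simp add: d_def)
    then show ?thesis
      using ne bdd by (subst (asm) cInf_less_iff) auto
  qed
  then obtain f where f: "\<And>n. f n \<in> V" "\<And>n. (norm (x - f n))\<^sup>2 < d + inverse (real (Suc n))"
    by metis
  have par: "(norm (f m - f n))\<^sup>2 \<le> 2 * inverse (real (Suc m)) + 2 * inverse (real (Suc n))" for m n
  proof -
    define h where "h = (1/2::real) *\<^sub>R (f m + f n)"
    have "h \<in> V"
      using V f(1) by (auto simp: h_def csubspace_def scaleR_scaleC)
    have "(norm (f m - f n))\<^sup>2 + 4 * (norm (x - h))\<^sup>2 = 2 * (norm (x - f m))\<^sup>2 + 2 * (norm (x - f n))\<^sup>2"
      unfolding power2_norm_eq_inner h_def
      by (simp add: inner_diff_left inner_diff_right inner_add_left inner_add_right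
          inner_commute[of "f n" "f m"] inner_commute[of x "f m"] inner_commute[of x "f n"]
          algebra_simps)
    with d_le[OF \<open>h \<in> V\<close>] f(2)[of m] f(2)[of n] show ?thesis by linarith
  qed
  have "Cauchy f"
    unfolding Cauchy_def
  proof (intro allI impI)
    fix e :: real assume "e > 0"
    then obtain N where N: "inverse (real (Suc N)) < e\<^sup>2 / 4"
      using reals_Archimedean[of "e\<^sup>2 / 4"] by auto
    show "\<exists>M. \<forall>m\<ge>M. \<forall>n\<ge>M. dist (f m) (f n) < e"
    proof (intro exI allI impI)
      fix m n assume "N \<le> m" "N \<le> n"
      then have "inverse (real (Suc m)) \<le> inverse (real (Suc N))"
        "inverse (real (Suc n)) \<le> inverse (real (Suc N))" by (auto intro: le_imp_inverse_le)
      then have "(norm (f m - f n))\<^sup>2 < e\<^sup>2" using par[of m n] N by linarith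
      then show "dist (f m) (f n) < e"
        using \<open>e > 0\<close> by (auto simp: dist_norm intro: power2_less_imp_less)
    qed
  qed
  then obtain p where p: "f \<longlonglongrightarrow> p"
    using Cauchy_convergent_iff convergent_def by blast
  have "p \<in> V"
    using V(2) f(1) p closed_sequentially by blast
  moreover have "(norm (x - p))\<^sup>2 \<le> d"
  proof (rule LIMSEQ_le)
    show "(\<lambda>n. (norm (x - f n))\<^sup>2) \<longlonglongrightarrow> (norm (x - p))\<^sup>2"
      by (intro tendsto_intros p)
    show "(\<lambda>n. d + inverse (real (Suc n))) \<longlonglongrightarrow> d"
      using tendsto_add[OF tendsto_const LIMSEQ_inverse_real_of_nat, of d] by simp
    show "\<exists>N. \<forall>n\<ge>N. (norm (x - f n))\<^sup>2 \<le> d + inverse (real (Suc n))"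
      using f(2) less_imp_le by blast
  qed
  ultimately show ?thesis
    using d_le by (meson norm_ge_zero order_trans power2_le_imp_le)
qed

text \<open>The nearest point \<open>p\<close> works: if \<open>x - p\<close> had a component along
  some \<open>m\<close> in \<open>V\<close>, moving \<open>p\<close> by that component would bring
  it closer to \<open>x\<close>.\<close>

lemma orthogonal_decomposition:
  fixes V :: "'a::complex_hilbert_space set"
  assumes V: "csubspace V" "closed V"
  shows "\<exists>p\<in>V. \<forall>m\<in>V. cinner (x - p) m = 0"
proof -
  obtain p where p: "p \<in> V" "\<And>m. m \<in> V \<Longrightarrow> norm (x - p) \<le> norm (x - m)"
    using nearest_point_exists[OF V] by blast
  have "cinner (x - p) m = 0" if m: "m \<in> V" for m
  proof (cases "m = 0")
    case False
    define w where "w = x - p"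
    \<comment> \<open>The coefficient of the projection of \<open>w\<close> onto the line through
      \<open>m\<close>, the choice that minimizes \<open>norm (w - c *\<^sub>C m)\<close>.\<close>
    define c where "c = cinner w m / of_real ((norm m)\<^sup>2)"
    have "p + c *\<^sub>C m \<in> V" using V p m by (auto simp: csubspace_def)
    from p(2)[OF this] have "(norm w)\<^sup>2 \<le> (norm (w - c *\<^sub>C m))\<^sup>2"
      by (simp add: w_def algebra_simps)
    also have "\<dots> = (norm w)\<^sup>2 - 2 * Re (cnj c * cinner w m) + (cmod c)\<^sup>2 * (norm m)\<^sup>2"
      by (simp add: norm_diff_squared cinner_simps norm_scaleC power_mult_distrib)
    also have "Re (cnj c * cinner w m) = (cmod (cinner w m))\<^sup>2 / (norm m)\<^sup>2"
    proof -
      have "cnj c * cinner w m = of_real ((cmod (cinner w m))\<^sup>2 / (norm m)\<^sup>2)"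
        by (simp add: c_def complex_norm_square mult.commute del: of_real_power)
      then show ?thesis by simp
    qed
    also have "(cmod c)\<^sup>2 * (norm m)\<^sup>2 = (cmod (cinner w m))\<^sup>2 / (norm m)\<^sup>2"
      using False by (simp add: c_def norm_divide norm_mult power2_eq_square)
    finally have "(cmod (cinner w m))\<^sup>2 / (norm m)\<^sup>2 \<le> 0" by simp
    then have "cinner w m = 0"
      using False by (simp add: divide_le_0_iff)
    then show ?thesis by (simp add: w_def)
  qed simp
  with p(1) show ?thesis by blast
qed

text \<open>The component in \<open>V\<close> is unique (\<open>uniq\<close>), so linearity only
  asks that the expected value lie in \<open>V\<close> and leave an orthogonal remainder. The bound
  1 comes from \<open>cinner (P x) (P x) = cinner x (P x)\<close>.\<close>

lemma orthogonal_projection_exists: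
  fixes V :: "'a::complex_hilbert_space set"
  assumes V: "csubspace V" "closed V"
  shows "\<exists>P. bounded_clinear P \<and> (\<forall>x. P x \<in> V \<and> (\<forall>m\<in>V. cinner (x - P x) m = 0))"
proof -
  obtain P where P: "\<And>x. P x \<in> V" "\<And>x m. m \<in> V \<Longrightarrow> cinner (x - P x) m = 0"
    using orthogonal_decomposition[OF V] by metis
  have uniq: "P x = p" if "p \<in> V" "\<And>m. m \<in> V \<Longrightarrow> cinner (x - p) m = 0" for x p
  proof -
    have d: "P x - p \<in> V" using P(1) that(1) csubspace_diff[OF V(1)] by blast
    have "cinner (P x - p) (P x - p) = cinner (x - p) (P x - p) - cinner (x - P x) (P x - p)"
      by (simp add: cinner_simps)
    then have "cinner (P x - p) (P x - p) = 0" using P(2) that(2) d by simp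
    then show ?thesis by (simp add: cinner_self)
  qed
  have "bounded_clinear P"
  proof (rule bounded_clinearI[where M = 1])
    fix x y show "P (x + y) = P x + P y"
    proof (rule uniq)
      show "P x + P y \<in> V" using V P(1) by (simp add: csubspace_def)
      show "cinner (x + y - (P x + P y)) m = 0" if "m \<in> V" for m
        using P(2)[OF that, of x] P(2)[OF that, of y] by (simp add: cinner_simps algebra_simps)
    qed
  next
    fix c x show "P (c *\<^sub>C x) = c *\<^sub>C P x"
    proof (rule uniq)
      show "c *\<^sub>C P x \<in> V" using V P(1) by (simp add: csubspace_def)
      show "cinner (c *\<^sub>C x - c *\<^sub>C P x) m = 0" if "m \<in> V" for m
        using P(2)[OF that, of x] by (simp add: cinner_simps)
    qed
  next
    fix x
    have "cinner (P x) (P x) = cinner x (P x)"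
      using P(2)[OF P(1), of x x] by (simp add: cinner_simps)
    then have "(norm (P x))\<^sup>2 \<le> norm x * norm (P x)"
      by (metis Re_cinner_self Re_cinner_le)
    then show "norm (P x) \<le> norm x * 1"
      by (cases "P x = 0") (auto simp: power2_eq_square)
  qed
  with P show ?thesis by blast
qed

text \<open>The orthogonal complement of the kernel of a nonzero functional is spanned by one vector
  \<open>z\<close>; since \<open>y - (f y / f z) *\<^sub>C z\<close> lies in the kernel, pairing it
  with \<open>z\<close> expresses \<open>f y\<close> by \<open>cinner y z\<close>.\<close>

lemma Riesz_representation:
  fixes f :: "'a::complex_hilbert_space \<Rightarrow> complex"
  assumes "bounded_clinear f"
  shows "\<exists>w. \<forall>x. f x = cinner x w"
proof (cases "\<forall>x. f x = 0")
  case True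
  then show ?thesis by (intro exI[of _ 0]) simp
next
  case False
  then obtain x where x: "f x \<noteq> 0" by blast
  define V where "V = {x. f x = 0}"
  have "csubspace V"
    using assms by (auto simp: csubspace_def V_def bounded_clinear_add bounded_clinear_scaleC
        bounded_clinear_zero)
  moreover have "closed V"
  proof -
    have "continuous_on UNIV f"
      using assms linear_continuous_on unfolding bounded_clinear_def by blast
    then have "closed (f -` {0})" by (intro closed_vimage) auto
    then show ?thesis by (simp add: V_def vimage_def)
  qed
  ultimately obtain p where p: "p \<in> V" "\<And>m. m \<in> V \<Longrightarrow> cinner (x - p) m = 0"
    using orthogonal_decomposition by blast
  define z where "z = x - p"
  have fz: "f z \<noteq> 0" and z: "z \<noteq> 0"
    using x p(1) assms by (auto simp: z_def V_def bounded_clinear_diff bounded_clinear_zero)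
  have "f y = cinner y (cnj (f z / of_real ((norm z)\<^sup>2)) *\<^sub>C z)" for y
  proof -
    have "y - (f y / f z) *\<^sub>C z \<in> V"
      using assms fz by (simp add: V_def bounded_clinear_diff bounded_clinear_scaleC scaleC_complex_def)
    then have "cinner z (y - (f y / f z) *\<^sub>C z) = 0" using p(2) z_def by blast
    then have "cinner (y - (f y / f z) *\<^sub>C z) z = 0"
      by (subst cinner_commute) simp
    then have "cinner y z = f y / f z * of_real ((norm z)\<^sup>2)"
      by (simp add: cinner_simps cinner_self)
    then show ?thesis using fz z by (simp add: cinner_simps)
  qed
  then show ?thesis by blast
qed

text \<open>Riesz representation supplies the value at each \<open>y\<close>, nondegeneracy gives
  linearity and uniqueness, and the bound of \<open>T\<close> carries over by testing the adjoint
  relation at \<open>S y\<close> itself.\<close>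

lemma cadjoint:
  fixes T :: "'a::complex_hilbert_space \<Rightarrow> 'b::complex_hilbert_space"
  assumes T: "bounded_clinear T"
  shows "bounded_clinear (cadjoint T)" "cinner (cadjoint T y) x = cinner y (T x)"
proof -
  obtain M where M: "M > 0" "\<And>x. norm (T x) \<le> norm x * M"
    using bounded_clinear_pos_bound[OF T] by blast
  have "\<exists>w. \<forall>x. cinner (T x) y = cinner x w" for y
  proof (rule Riesz_representation, rule bounded_clinearI[where M = "M * norm y"])
    show "norm (cinner (T x) y) \<le> norm x * (M * norm y)" for x
      using cmod_cinner_le[of "T x" y] mult_right_mono[OF M(2)[of x], of "norm y"]
      by (simp add: mult.assoc)
  qed (use T in \<open>auto simp: bounded_clinear_add bounded_clinear_scaleC cinner_simps scaleC_complex_def\<close>)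
  then obtain S where S: "\<And>x y. cinner (T x) y = cinner x (S y)" by metis
  have S': "cinner (S y) x = cinner y (T x)" for x y
    using S[of x y] by (metis cinner_commute)
  have eq: "u = v" if "\<And>x. cinner u x = cinner v x" for u v :: 'a
  proof -
    have "cinner (u - v) (u - v) = 0" using that by (simp add: cinner_simps)
    then show ?thesis by (simp add: cinner_self)
  qed
  have "bounded_clinear S"
  proof (rule bounded_clinearI[where M = M])
    show "S (x + y) = S x + S y" for x y by (rule eq) (simp add: S' cinner_simps)
    show "S (c *\<^sub>C x) = c *\<^sub>C S x" for c x by (rule eq) (simp add: S' cinner_simps)
    fix y
    have "(norm (S y))\<^sup>2 \<le> norm y * norm (T (S y))"
      by (metis Re_cinner_self S' Re_cinner_le)
    also have "\<dots> \<le> norm y * (norm (S y) * M)"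
      by (intro mult_left_mono M) auto
    finally show "norm (S y) \<le> norm y * M"
      by (cases "S y = 0") (use M in \<open>auto simp: power2_eq_square mult_ac\<close>)
  qed
  then have "\<exists>!S. bounded_clinear S \<and> (\<forall>x y. cinner (S y) x = cinner y (T x))"
    using S' by (intro ex1I[of _ S]) (auto intro!: eq ext)
  from theI'[OF this]
  show "bounded_clinear (cadjoint T)" "cinner (cadjoint T y) x = cinner y (T x)"
    by (auto simp: cadjoint_def)
qed

text \<open>Any solution \<open>S\<close> of \<open>A \<circ> S = cadjoint T \<circ> A\<close>
  becomes one with range in \<open>closure (range A)\<close> after composition with the projection
  \<open>P\<close>, because \<open>A\<close> does not see the part removed by \<open>P\<close>.
  Uniqueness holds because \<open>A\<close> is injective on that closure.\<close>

lemma A_sharp: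
  fixes A T :: "'a::complex_hilbert_space \<Rightarrow> 'a"
  assumes A: "positive_op A" and T: "T \<in> A_bounded_ops A"
  shows "bounded_clinear (A_sharp A T)"
    and "A_inner A (T x) y = A_inner A x (A_sharp A T y)"
proof -
  have bA: "bounded_clinear A" using A by (simp add: positive_op_def)
  have sa: "cinner (A x) y = cinner x (A y)" for x y
    by (rule positive_op_selfadjoint[OF A])
  obtain S where S: "bounded_clinear S" "A \<circ> S = cadjoint T \<circ> A" and bT: "bounded_clinear T"
    using T unfolding A_bounded_ops_def by blast
  define V where "V = closure (range A)"
  have "csubspace (range A)"
    by (rule csubspace_range[OF bounded_clinear_add[OF bA] bounded_clinear_scaleC[OF bA]])
  then have "csubspace V" unfolding V_def by (rule csubspace_closure)
  moreover have "closed V" by (simp add: V_def)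
  ultimately obtain P where "bounded_clinear P \<and>
      (\<forall>x. P x \<in> V \<and> (\<forall>m\<in>V. cinner (x - P x) m = 0))"
    using orthogonal_projection_exists[of V] by blast
  then have P: "bounded_clinear P" "\<And>x. P x \<in> V"
    "\<And>x m. m \<in> V \<Longrightarrow> cinner (x - P x) m = 0"
    by auto
  \<comment> \<open>By self-adjointness the squared norm of this vector is the inner product of
    \<open>x - P x\<close> with a vector of the range of \<open>A\<close>.\<close>
  have "A (x - P x) = 0" for x
  proof -
    have "A (A (x - P x)) \<in> V"
      unfolding V_def by (rule subsetD[OF closure_subset]) simp
    then have "cinner (A (x - P x)) (A (x - P x)) = 0"
      by (subst sa) (rule P(3))
    then show ?thesis by (simp add: cinner_self)
  qed
  then have AP: "A (P x) = A x" for x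
    by (simp add: bounded_clinear_diff[OF bA])
  \<comment> \<open>A kernel vector is orthogonal to the range of the self-adjoint \<open>A\<close>,
    hence to its closure, hence to itself.\<close>
  have ker: "w = 0" if "w \<in> V" "A w = 0" for w
  proof -
    from \<open>w \<in> V\<close> obtain f where f: "\<And>n. f n \<in> range A" "f \<longlonglongrightarrow> w"
      unfolding V_def closure_sequential by blast
    have "cinner w (f n) = 0" for n
      using f(1)[of n] that(2) by (auto simp: sa[symmetric])
    moreover have "(\<lambda>n. cinner w (f n)) \<longlonglongrightarrow> cinner w w"
      by (intro tendsto_intros f)
    ultimately have "cinner w w = 0" by (simp add: LIMSEQ_const_iff)
    then show ?thesis by (simp add: cinner_self)
  qed
  have "\<exists>!S. bounded_clinear S \<and> A \<circ> S = cadjoint T \<circ> A \<and> range S \<subseteq> closure (range A)"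
  proof (rule ex1I[of _ "P \<circ> S"])
    show "bounded_clinear (P \<circ> S) \<and> A \<circ> (P \<circ> S) = cadjoint T \<circ> A \<and> range (P \<circ> S) \<subseteq> closure (range A)"
    proof (intro conjI)
      show "A \<circ> (P \<circ> S) = cadjoint T \<circ> A"
        using AP S(2) by (simp add: o_def)
      show "range (P \<circ> S) \<subseteq> closure (range A)"
        using P(2) unfolding V_def by (simp add: image_subset_iff)
    qed (rule bounded_clinear_comp[OF P(1) S(1)])
  next
    fix R assume R: "bounded_clinear R \<and> A \<circ> R = cadjoint T \<circ> A \<and> range R \<subseteq> closure (range A)"
    show "R = P \<circ> S"
    proof
      fix x
      have "R x - P (S x) \<in> V"
        using R P(2) \<open>csubspace V\<close> unfolding V_def
        by (intro csubspace_diff) (simp_all add: image_subset_iff)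
      moreover have "(A \<circ> R) x = (A \<circ> S) x"
        using R S(2) by simp
      then have "A (R x - P (S x)) = 0"
        using AP by (simp add: bounded_clinear_diff[OF bA])
      ultimately show "R x = (P \<circ> S) x" using ker[of "R x - P (S x)"] by simp
    qed
  qed
  from theI'[OF this] have sharp: "bounded_clinear (A_sharp A T)"
    "A \<circ> A_sharp A T = cadjoint T \<circ> A"
    unfolding A_sharp_def[symmetric] by blast+
  then show "bounded_clinear (A_sharp A T)" by blast
  have "cinner (T x) (A y) = cnj (cinner (cadjoint T (A y)) x)"
    using cinner_commute[of "T x" "A y"] by (simp add: cadjoint(2)[OF bT])
  also have "cadjoint T (A y) = A (A_sharp A T y)"
    using fun_cong[OF sharp(2), of y] by simp
  finally show "A_inner A (T x) y = A_inner A x (A_sharp A T y)"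
    using cinner_commute[of x "A (A_sharp A T y)"] by (simp add: A_inner_def sa)
qed


section \<open>Inverses and spectra on a closed subspace\<close>

definition invertible_on :: "'k::complex_hilbert_space set \<Rightarrow> ('k \<Rightarrow> 'k) \<Rightarrow> bool"
  where "invertible_on K T \<longleftrightarrow> (\<exists>R. bounded_op_on K R \<and> (\<forall>x\<in>K. R (T x) = x \<and> T (R x) = x))"

text \<open>Symmetry makes the quadratic form real, so nonnegativity is asked of its real part
  only.\<close>

definition psd_on :: "'k::complex_hilbert_space set \<Rightarrow> ('k \<Rightarrow> 'k) \<Rightarrow> bool"
  where "psd_on K T \<longleftrightarrow> bounded_op_on K T \<and> (\<forall>x\<in>K. \<forall>y\<in>K. cinner (T x) y = cinner x (T y)) \<and>
    (\<forall>x\<in>K. 0 \<le> Re (cinner (T x) x))"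

lemma spectrum_on_iff: "z \<in> spectrum_on K T \<longleftrightarrow> \<not> invertible_on K (\<lambda>x. T x - z *\<^sub>C x)"
  by (simp add: spectrum_on_def invertible_on_def)

lemma bounded_op_onI:
  assumes "\<And>x. x \<in> K \<Longrightarrow> T x \<in> K" "\<And>x y. x \<in> K \<Longrightarrow> y \<in> K \<Longrightarrow> T (x + y) = T x + T y"
    "\<And>c x. x \<in> K \<Longrightarrow> T (c *\<^sub>C x) = c *\<^sub>C T x" "\<And>x. x \<in> K \<Longrightarrow> norm (T x) \<le> M * norm x"
  shows "bounded_op_on K T"
  using assms unfolding bounded_op_on_def by blast

lemma bounded_op_on_cong:
  assumes "\<And>x. x \<in> K \<Longrightarrow> S x = T x" "csubspace K"
  shows "bounded_op_on K S \<longleftrightarrow> bounded_op_on K T"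
  using assms unfolding bounded_op_on_def csubspace_def by simp

lemma bounded_op_on_in: "bounded_op_on K T \<Longrightarrow> x \<in> K \<Longrightarrow> T x \<in> K"
  by (simp add: bounded_op_on_def)

lemma bounded_op_on_add:
  "bounded_op_on K T \<Longrightarrow> x \<in> K \<Longrightarrow> y \<in> K \<Longrightarrow> T (x + y) = T x + T y"
  by (simp add: bounded_op_on_def)

lemma bounded_op_on_scaleC: "bounded_op_on K T \<Longrightarrow> x \<in> K \<Longrightarrow> T (c *\<^sub>C x) = c *\<^sub>C T x"
  by (simp add: bounded_op_on_def)

lemma bounded_op_on_pos_bound:
  assumes "bounded_op_on K T"
  obtains M where "M > 0" "\<And>x. x \<in> K \<Longrightarrow> norm (T x) \<le> M * norm x"
proof -
  from assms obtain M where M: "\<And>x. x \<in> K \<Longrightarrow> norm (T x) \<le> M * norm x"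
    unfolding bounded_op_on_def by blast
  show thesis
  proof (rule that[of "max M 1"])
    fix x assume "x \<in> K"
    then show "norm (T x) \<le> max M 1 * norm x"
      using M[of x] mult_right_mono[of M "max M 1" "norm x"] by simp
  qed simp
qed

locale closed_csubspace =
  fixes K :: "'k::complex_hilbert_space set"
  assumes sub: "csubspace K" and clo: "closed K"
begin

lemma zero_in: "0 \<in> K" and add_in: "x \<in> K \<Longrightarrow> y \<in> K \<Longrightarrow> x + y \<in> K"
  and scaleC_in: "x \<in> K \<Longrightarrow> c *\<^sub>C x \<in> K"
  using sub by (auto simp: csubspace_def)

lemma diff_in: "x \<in> K \<Longrightarrow> y \<in> K \<Longrightarrow> x - y \<in> K"
  by (rule csubspace_diff[OF sub])

lemma op_zero: "bounded_op_on K T \<Longrightarrow> T 0 = 0"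
  using bounded_op_on_scaleC[of K T 0 0] zero_in by simp

lemma op_diff: "bounded_op_on K T \<Longrightarrow> x \<in> K \<Longrightarrow> y \<in> K \<Longrightarrow> T (x - y) = T x - T y"
  using bounded_op_on_add[of K T x "(-1) *\<^sub>C y"] bounded_op_on_scaleC[of K T y "-1"] scaleC_in[of y "-1"]
  by (simp add: scaleC_minus_one)

lemma op_sum:
  assumes "bounded_op_on K T" "\<And>i. i \<in> I \<Longrightarrow> f i \<in> K"
  shows "T (\<Sum>i\<in>I. f i) = (\<Sum>i\<in>I. T (f i))" "(\<Sum>i\<in>I. f i) \<in> K"
proof -
  have "T (\<Sum>i\<in>I. f i) = (\<Sum>i\<in>I. T (f i)) \<and> (\<Sum>i\<in>I. f i) \<in> K"
    using assms(2)
    by (induction I rule: infinite_finite_induct)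
       (auto simp: op_zero[OF assms(1)] bounded_op_on_add[OF assms(1)] zero_in add_in)
  then show "T (\<Sum>i\<in>I. f i) = (\<Sum>i\<in>I. T (f i))" "(\<Sum>i\<in>I. f i) \<in> K" by auto
qed

lemma bounded_op_on_comp:
  assumes S: "bounded_op_on K S" and T: "bounded_op_on K T"
  shows "bounded_op_on K (\<lambda>x. S (T x))"
proof -
  obtain M N where M: "M > 0" "\<And>x. x \<in> K \<Longrightarrow> norm (S x) \<le> M * norm x"
    and N: "N > 0" "\<And>x. x \<in> K \<Longrightarrow> norm (T x) \<le> N * norm x"
    using bounded_op_on_pos_bound[OF S] bounded_op_on_pos_bound[OF T] by metis
  show ?thesis
  proof (rule bounded_op_onI[where M = "M * N"])
    fix x assume x: "x \<in> K"
    show "norm (S (T x)) \<le> M * N * norm x"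
      using order_trans[OF M(2)[OF bounded_op_on_in[OF T x]] mult_left_mono[OF N(2)[OF x], of M]] M(1)
      by (simp add: mult.assoc)
  qed (use S T in \<open>auto simp: bounded_op_on_def\<close>)
qed

lemma bounded_op_on_lincomb:
  assumes S: "bounded_op_on K S" and T: "bounded_op_on K T"
  shows "bounded_op_on K (\<lambda>x. c *\<^sub>C S x + d *\<^sub>C T x)"
proof -
  obtain M N where M: "M > 0" "\<And>x. x \<in> K \<Longrightarrow> norm (S x) \<le> M * norm x"
    and N: "N > 0" "\<And>x. x \<in> K \<Longrightarrow> norm (T x) \<le> N * norm x"
    using bounded_op_on_pos_bound[OF S] bounded_op_on_pos_bound[OF T] by metis
  show ?thesis
  proof (rule bounded_op_onI[where M = "cmod c * M + cmod d * N"])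
    fix x assume x: "x \<in> K"
    have "norm (c *\<^sub>C S x + d *\<^sub>C T x) \<le> cmod c * norm (S x) + cmod d * norm (T x)"
      by (rule order_trans[OF norm_triangle_ineq]) (simp add: norm_scaleC)
    also have "\<dots> \<le> cmod c * (M * norm x) + cmod d * (N * norm x)"
      by (intro add_mono mult_left_mono M N x) auto
    finally show "norm (c *\<^sub>C S x + d *\<^sub>C T x) \<le> (cmod c * M + cmod d * N) * norm x"
      by (simp add: algebra_simps)
  qed (use assms in \<open>auto simp: bounded_op_on_def add_in scaleC_in scaleC_add_right scaleC_scaleC mult.commute\<close>)
qed

lemma bounded_op_on_ident: "bounded_op_on K (\<lambda>x. x)"
  by (rule bounded_op_onI[where M = 1]) auto

lemma bounded_op_on_diff:
  "bounded_op_on K S \<Longrightarrow> bounded_op_on K T \<Longrightarrow> bounded_op_on K (\<lambda>x. S x - T x)"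
  using bounded_op_on_lincomb[of S T 1 "-1"] by (simp add: scaleC_minus_one)

lemma bounded_op_on_plus:
  "bounded_op_on K S \<Longrightarrow> bounded_op_on K T \<Longrightarrow> bounded_op_on K (\<lambda>x. S x + T x)"
  using bounded_op_on_lincomb[of S T 1 1] by simp

lemma onorm_on_le:
  assumes "\<And>x. x \<in> K \<Longrightarrow> norm (T x) \<le> M * norm x" "M \<ge> 0"
  shows "onorm_on K T \<le> M"
  unfolding onorm_on_def
proof (rule cSUP_least)
  show "norm (T x) / norm x \<le> M" if "x \<in> K" for x
    using assms(1)[OF that] assms(2) by (cases "x = 0") (auto simp: divide_le_eq)
qed (use zero_in in auto)

lemma norm_le_onorm_on:
  assumes T: "bounded_op_on K T" and x: "x \<in> K"
  shows "norm (T x) \<le> onorm_on K T * norm x"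
proof (cases "x = 0")
  case False
  obtain M where M: "M > 0" "\<And>x. x \<in> K \<Longrightarrow> norm (T x) \<le> M * norm x"
    using bounded_op_on_pos_bound[OF T] by metis
  have "bdd_above ((\<lambda>x. norm (T x) / norm x) ` K)"
  proof (rule bdd_aboveI2)
    show "norm (T x) / norm x \<le> M" if "x \<in> K" for x
      using M(2)[OF that] M(1) by (cases "x = 0") (auto simp: divide_le_eq)
  qed
  then have "norm (T x) / norm x \<le> onorm_on K T"
    unfolding onorm_on_def using x by (rule cSUP_upper[rotated])
  then show ?thesis using False by (simp add: divide_le_eq)
qed (simp add: op_zero[OF T])

lemma onorm_on_nonneg:
  assumes T: "bounded_op_on K T"
  shows "0 \<le> onorm_on K T"
proof (cases "\<exists>x\<in>K. x \<noteq> 0")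
  case True
  then obtain x where "x \<in> K" "x \<noteq> 0" by blast
  then have "0 \<le> onorm_on K T * norm x" "0 < norm x"
    using order_trans[OF norm_ge_zero norm_le_onorm_on[OF T, of x]] by auto
  then show ?thesis by (simp add: zero_le_mult_iff)
next
  case False
  then have "K = {0}" using zero_in by blast
  \<comment> \<open>The supremum is over the single quotient 0 / 0, which is 0.\<close>
  then show ?thesis by (simp add: onorm_on_def)
qed

lemma invertible_on_comp:
  assumes "invertible_on K S" "invertible_on K T" "bounded_op_on K T" "bounded_op_on K S"
  shows "invertible_on K (\<lambda>x. S (T x))"
proof -
  obtain P where P: "bounded_op_on K P" "\<And>x. x \<in> K \<Longrightarrow> P (S x) = x" "\<And>x. x \<in> K \<Longrightarrow> S (P x) = x"
    using assms(1) unfolding invertible_on_def by blast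
  obtain Q where Q: "bounded_op_on K Q" "\<And>x. x \<in> K \<Longrightarrow> Q (T x) = x" "\<And>x. x \<in> K \<Longrightarrow> T (Q x) = x"
    using assms(2) unfolding invertible_on_def by blast
  show ?thesis
    unfolding invertible_on_def
  proof (intro exI[of _ "\<lambda>x. Q (P x)"] conjI ballI)
    show "bounded_op_on K (\<lambda>x. Q (P x))" using Q(1) P(1) by (rule bounded_op_on_comp)
  qed (simp_all add: P Q bounded_op_on_in[OF assms(3)] bounded_op_on_in[OF P(1)])
qed

text \<open>Meant for \<open>T - z\<close>, of which often only a suitable multiple, for instance by
  an imaginary unit, is coercive.\<close>

lemma invertible_on_scaleC_cancel:
  assumes "invertible_on K (\<lambda>x. c *\<^sub>C S x)" "bounded_op_on K S"
  shows "invertible_on K S"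
proof -
  obtain R where R: "bounded_op_on K R" "\<And>x. x \<in> K \<Longrightarrow> R (c *\<^sub>C S x) = x \<and> c *\<^sub>C S (R x) = x"
    using assms(1) by (auto simp: invertible_on_def)
  have "bounded_op_on K (\<lambda>x. R (c *\<^sub>C x))"
    using bounded_op_on_comp[OF R(1) bounded_op_on_lincomb[OF bounded_op_on_ident bounded_op_on_ident, of c 0]]
    by simp
  moreover have "S (R (c *\<^sub>C x)) = x" if "x \<in> K" for x
  proof -
    have "S (R (c *\<^sub>C x)) = S (c *\<^sub>C R x)"
      using bounded_op_on_scaleC[OF R(1) that] by simp
    also have "\<dots> = c *\<^sub>C S (R x)"
      using bounded_op_on_scaleC[OF assms(2) bounded_op_on_in[OF R(1) that]] by simp
    finally show ?thesis using R(2)[OF that] by simp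
  qed
  ultimately show ?thesis
    unfolding invertible_on_def
    by (intro exI[of _ "\<lambda>x. R (c *\<^sub>C x)"]) (simp add: R(2))
qed

text \<open>Lax--Milgram: for small \<open>t\<close> the map \<open>x \<mapsto> x - t (T x - y)\<close> is a contraction.\<close>

lemma coercive_imp_invertible_on:
  assumes T: "bounded_op_on K T" and c: "c > 0"
    and coer: "\<And>x. x \<in> K \<Longrightarrow> c * (norm x)\<^sup>2 \<le> Re (cinner (T x) x)"
  shows "invertible_on K T"
proof -
  obtain M0 where M0: "M0 > 0" "\<And>x. x \<in> K \<Longrightarrow> norm (T x) \<le> M0 * norm x"
    using bounded_op_on_pos_bound[OF T] by metis
  \<comment> \<open>The maximum with \<open>c\<close> guarantees \<open>c / M \<le> 1\<close>, so
    that \<open>q\<close> is a square root of a nonnegative number.\<close>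
  define M where "M = max M0 c"
  have M: "M > 0" "c \<le> M" using M0 c by (auto simp: M_def)
  have MT: "norm (T x) \<le> M * norm x" if "x \<in> K" for x
    using M0(2)[OF that] mult_right_mono[of M0 M "norm x"] by (simp add: M_def)
  \<comment> \<open>This \<open>t\<close> minimizes
    \<open>1 - 2 * t * c + t\<^sup>2 * M\<^sup>2\<close>, the bound on the squared contraction
    factor; the minimum is \<open>q\<^sup>2\<close>.\<close>
  define t where "t = c / M\<^sup>2"
  define q where "q = sqrt (1 - (c / M)\<^sup>2)"
  have cM: "0 < c / M" "c / M \<le> 1" using M c by auto
  then have cM2: "0 < (c / M)\<^sup>2" "(c / M)\<^sup>2 \<le> 1" by (auto simp: power_le_one)
  then have q: "0 \<le> q" "q < 1" by (auto simp: q_def)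
  have contr: "norm (x - t *\<^sub>R T x) \<le> q * norm x" if x: "x \<in> K" for x
  proof -
    have tpos: "t > 0" using M c by (simp add: t_def)
    have "(norm (x - t *\<^sub>R T x))\<^sup>2 = (norm x)\<^sup>2 - 2 * (t * Re (cinner (T x) x)) + t\<^sup>2 * (norm (T x))\<^sup>2"
    proof -
      have "Re (cinner x (T x)) = Re (cinner (T x) x)" by (subst cinner_commute) simp
      then show ?thesis
        by (simp add: norm_diff_squared scaleR_scaleC cinner_simps norm_scaleC power_mult_distrib)
    qed
    also have "\<dots> \<le> (norm x)\<^sup>2 - 2 * (t * (c * (norm x)\<^sup>2)) + t\<^sup>2 * (M * norm x)\<^sup>2"
      using coer[OF x] MT[OF x] tpos by (intro add_mono diff_mono mult_left_mono power_mono) auto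
    also have "\<dots> = (1 - (c / M)\<^sup>2) * (norm x)\<^sup>2"
      using M(1) by (simp add: t_def field_simps power2_eq_square)
    also have "\<dots> = (q * norm x)\<^sup>2"
      using cM2 by (simp add: q_def power_mult_distrib)
    finally show ?thesis
      by (rule power2_le_imp_le) (use q in simp)
  qed
  have "\<exists>x\<in>K. T x = y" if y: "y \<in> K" for y
  proof -
    define g where "g x = x - t *\<^sub>R (T x - y)" for x
    have "\<exists>!x\<in>K. g x = x"
    proof (rule Banach_fix[of K q])
      show "complete K" using clo by (simp add: complete_eq_closed)
      show "g ` K \<subseteq> K"
        using y bounded_op_on_in[OF T] by (auto simp: g_def scaleR_scaleC intro!: diff_in scaleC_in)
      fix x z assume "x \<in> K" "z \<in> K"
      then have "dist (g x) (g z) = norm ((x - z) - t *\<^sub>R T (x - z))"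
        by (simp add: dist_norm g_def op_diff[OF T] algebra_simps)
      also have "\<dots> \<le> q * norm (x - z)"
        using \<open>x \<in> K\<close> \<open>z \<in> K\<close> by (intro contr diff_in)
      finally show "dist (g x) (g z) \<le> q * dist x z" by (simp add: dist_norm)
    qed (use q zero_in in auto)
    then obtain x where "x \<in> K" "g x = x" by blast
    moreover have "t \<noteq> 0" using c M by (simp add: t_def)
    ultimately show ?thesis by (auto simp: g_def)
  qed
  then obtain R where R: "\<And>y. y \<in> K \<Longrightarrow> R y \<in> K" "\<And>y. y \<in> K \<Longrightarrow> T (R y) = y"
    by metis
  have below: "norm x \<le> (1 / c) * norm (T x)" if "x \<in> K" for x
  proof (cases "x = 0")
    case False
    have "c * (norm x)\<^sup>2 \<le> norm (T x) * norm x"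
      using coer[OF that] Re_cinner_le order_trans by blast
    then show ?thesis using False c by (simp add: power2_eq_square field_simps)
  qed (simp add: c less_imp_le)
  have inj: "x = y" if "x \<in> K" "y \<in> K" "T x = T y" for x y
    using below[of "x - y"] that by (simp add: op_diff[OF T] diff_in)
  have "bounded_op_on K R"
  proof (rule bounded_op_onI[where M = "1 / c"])
    show "norm (R x) \<le> 1 / c * norm x" if "x \<in> K" for x
      using below[OF R(1)[OF that]] R(2)[OF that] by simp
    show "R (x + y) = R x + R y" if "x \<in> K" "y \<in> K" for x y
      by (rule inj) (simp_all add: that R add_in bounded_op_on_add[OF T])
    show "R (c *\<^sub>C x) = c *\<^sub>C R x" if "x \<in> K" for c x
      by (rule inj) (simp_all add: that R scaleC_in bounded_op_on_scaleC[OF T])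
  qed (rule R(1))
  moreover have "R (T x) = x" if "x \<in> K" for x
    by (rule inj) (simp_all add: that R bounded_op_on_in[OF T])
  ultimately show ?thesis
    unfolding invertible_on_def by (intro exI[of _ R]) (simp add: R(2))
qed

section \<open>Positive operators: coercivity and location of the spectrum\<close>

text \<open>The form of \<open>S\<close> is nonnegative at \<open>x - S x / C\<close>. Expanding it
  and estimating the quadratic term by \<open>C\<close> leaves the claim; the step 1 / C is the one
  that makes the negative contribution largest.\<close>

lemma psd_on_norm_le:
  assumes S: "psd_on K S" and C: "C > 0" "\<And>x. x \<in> K \<Longrightarrow> norm (S x) \<le> C * norm x"
    and x: "x \<in> K"
  shows "(norm (S x))\<^sup>2 \<le> C * Re (cinner (S x) x)"
proof -
  have bS: "bounded_op_on K S" using S by (simp add: psd_on_def)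
  define d where "d = 1 / C"
  define w where "w = complex_of_real d *\<^sub>C S x"
  have wK: "w \<in> K" and SxK: "S x \<in> K"
    using bounded_op_on_in[OF bS x] by (auto simp: w_def scaleC_in)
  have 1: "cinner (S (S x)) x = of_real ((norm (S x))\<^sup>2)"
    using S x SxK by (simp add: psd_on_def cinner_self)
  have 2: "cinner (S x) (S x) = of_real ((norm (S x))\<^sup>2)"
    by (rule cinner_self)
  have 3: "S (x - w) = S x - of_real d *\<^sub>C S (S x)"
    using x wK SxK by (simp add: op_diff[OF bS] w_def bounded_op_on_scaleC[OF bS])
  have "cinner (S (x - w)) (x - w) =
      cinner (S x) x - of_real (2 * d * (norm (S x))\<^sup>2) + of_real (d\<^sup>2) * cinner (S (S x)) (S x)"
    unfolding 3 by (simp add: w_def cinner_simps 1 2 power2_eq_square algebra_simps)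
  moreover have "0 \<le> Re (cinner (S (x - w)) (x - w))"
    using S diff_in[OF x wK] unfolding psd_on_def by blast
  ultimately have "0 \<le> Re (cinner (S x) x) - 2 * d * (norm (S x))\<^sup>2 + d\<^sup>2 * Re (cinner (S (S x)) (S x))"
    by simp
  also have "Re (cinner (S (S x)) (S x)) \<le> C * (norm (S x))\<^sup>2"
    using Re_cinner_le[of "S (S x)" "S x"] mult_right_mono[OF C(2)[OF SxK], of "norm (S x)"]
    by (simp add: power2_eq_square)
  finally have "0 \<le> Re (cinner (S x) x) - 2 * d * (norm (S x))\<^sup>2 + d\<^sup>2 * (C * (norm (S x))\<^sup>2)"
    by (simp add: mult_left_mono)
  then show ?thesis using C(1) by (simp add: d_def field_simps power2_eq_square)
qed

text \<open>A bounded inverse bounds \<open>norm x\<close> by \<open>norm (S x)\<close>, and for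
  positive \<open>S\<close> the latter is controlled by the form. Together with the Lax-Milgram
  argument this identifies invertibility with coercivity for positive operators.\<close>

lemma psd_on_invertible_imp_coercive:
  assumes S: "psd_on K S" and "invertible_on K S"
  shows "\<exists>e>0. \<forall>x\<in>K. e * (norm x)\<^sup>2 \<le> Re (cinner (S x) x)"
proof -
  have bS: "bounded_op_on K S" using S by (simp add: psd_on_def)
  obtain R where R: "bounded_op_on K R" "\<And>x. x \<in> K \<Longrightarrow> R (S x) = x"
    using assms(2) by (auto simp: invertible_on_def)
  obtain C where C: "C > 0" "\<And>x. x \<in> K \<Longrightarrow> norm (S x) \<le> C * norm x"
    using bounded_op_on_pos_bound[OF bS] by metis
  obtain M where M: "M > 0" "\<And>x. x \<in> K \<Longrightarrow> norm (R x) \<le> M * norm x"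
    using bounded_op_on_pos_bound[OF R(1)] by metis
  have "1 / (M\<^sup>2 * C) * (norm x)\<^sup>2 \<le> Re (cinner (S x) x)" if x: "x \<in> K" for x
  proof -
    have "norm x \<le> M * norm (S x)"
      using M(2)[OF bounded_op_on_in[OF bS x]] R(2)[OF x] by simp
    then have "(norm x)\<^sup>2 \<le> M\<^sup>2 * (norm (S x))\<^sup>2"
      using power_mono[of "norm x" "M * norm (S x)" 2] by (simp add: power_mult_distrib)
    also have "\<dots> \<le> M\<^sup>2 * (C * Re (cinner (S x) x))"
      by (intro mult_left_mono psd_on_norm_le[OF S C x]) auto
    finally show ?thesis using M(1) C(1) by (simp add: field_simps)
  qed
  moreover have "1 / (M\<^sup>2 * C) > 0" using M(1) C(1) by simp
  ultimately show ?thesis by blast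
qed

text \<open>Outside the segment a multiple of \<open>T - z\<close> is coercive. Since the form of
  \<open>T\<close> is real, a factor of plus or minus the imaginary unit isolates the imaginary part
  of \<open>z\<close>; left of 0 positivity suffices with factor 1, and right of \<open>L\<close>
  the norm bound with factor -1.\<close>

lemma spectrum_on_psd:
  assumes T: "psd_on K T" and L: "\<And>x. x \<in> K \<Longrightarrow> norm (T x) \<le> L * norm x"
    and z: "z \<in> spectrum_on K T"
  shows "\<exists>t\<in>{0..L}. z = of_real t"
proof (rule ccontr)
  assume neg: "\<not> ?thesis"
  have bT: "bounded_op_on K T" using T by (simp add: psd_on_def)
  have z': "Im z \<noteq> 0 \<or> Re z < 0 \<or> Re z > L"
  proof (rule ccontr)
    assume "\<not> ?thesis"
    then have "z = of_real (Re z)" "Re z \<in> {0..L}" by (auto simp: complex_eq_iff)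
    then show False using neg by blast
  qed
  have bU: "bounded_op_on K (\<lambda>x. T x - z *\<^sub>C x)"
    using bounded_op_on_lincomb[OF bT bounded_op_on_ident, of 1 "-z"] by (simp add: scaleC_minus_left)
  have real: "Im (cinner (T x) x) = 0" if "x \<in> K" for x
  proof -
    have "cinner (T x) x = cnj (cinner (T x) x)"
      using T that cinner_commute[of "T x" x] by (simp add: psd_on_def)
    then have "Im (cinner (T x) x) = Im (cnj (cinner (T x) x))" by (rule arg_cong)
    then show ?thesis by simp
  qed
  have "\<exists>c d. d > 0 \<and> (\<forall>x\<in>K. d * (norm x)\<^sup>2 \<le> Re (c * (cinner (T x) x - z * of_real ((norm x)\<^sup>2))))"
  proof -
    consider "Im z \<noteq> 0" | "Re z < 0" | "Re z > L" using z' by blast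
    then show ?thesis
    proof cases
      case 1
      have "\<bar>Im z\<bar> * (norm x)\<^sup>2 \<le> Re ((\<i> * of_real (sgn (Im z))) * (cinner (T x) x - z * of_real ((norm x)\<^sup>2)))"
        if "x \<in> K" for x
        using real[OF that] 1 by (simp add: sgn_if)
      moreover have "\<bar>Im z\<bar> > 0" using 1 by simp
      ultimately show ?thesis by blast
    next
      case 2
      have "- Re z * (norm x)\<^sup>2 \<le> Re (1 * (cinner (T x) x - z * of_real ((norm x)\<^sup>2)))" if "x \<in> K" for x
      proof -
        have "0 \<le> Re (cinner (T x) x)" using T that unfolding psd_on_def by blast
        then show ?thesis by simp
      qed
      moreover have "- Re z > 0" using 2 by simp
      ultimately show ?thesis by blast
    next
      case 3
      have "(Re z - L) * (norm x)\<^sup>2 \<le> Re (-1 * (cinner (T x) x - z * of_real ((norm x)\<^sup>2)))" if "x \<in> K" for x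
        using Re_cinner_le[of "T x" x] mult_right_mono[OF L[OF that], of "norm x"]
        by (simp add: algebra_simps power2_eq_square)
      moreover have "Re z - L > 0" using 3 by simp
      ultimately show ?thesis by blast
    qed
  qed
  then obtain c d where cd: "d > 0"
    "\<And>x. x \<in> K \<Longrightarrow> d * (norm x)\<^sup>2 \<le> Re (c * (cinner (T x) x - z * of_real ((norm x)\<^sup>2)))"
    by blast
  have "invertible_on K (\<lambda>x. c *\<^sub>C (T x - z *\<^sub>C x))"
  proof (rule coercive_imp_invertible_on[OF _ cd(1)])
    show "bounded_op_on K (\<lambda>x. c *\<^sub>C (T x - z *\<^sub>C x))"
      using bounded_op_on_lincomb[OF bU bU, of c 0] by simp
    show "d * (norm x)\<^sup>2 \<le> Re (cinner (c *\<^sub>C (T x - z *\<^sub>C x)) x)" if "x \<in> K" for x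
      using cd(2)[OF that] by (simp only: cinner_simps cinner_self)
  qed
  then have "invertible_on K (\<lambda>x. T x - z *\<^sub>C x)"
    using bU by (rule invertible_on_scaleC_cancel)
  then show False using z by (simp add: spectrum_on_iff)
qed

section \<open>Polynomials in an operator\<close>

lemma funpow_in: "bounded_op_on K T \<Longrightarrow> x \<in> K \<Longrightarrow> (T ^^ i) x \<in> K"
  by (induction i) (auto simp: bounded_op_on_in)

lemma poly_op_0 [simp]: "poly_op 0 T x = 0"
  by (simp add: poly_op_def)

text \<open>Horner's rule, by which the algebra of \<open>poly_op\<close> reduces to induction over
  \<open>pCons\<close> instead of manipulation of sums.\<close>

lemma poly_op_pCons:
  assumes T: "bounded_op_on K T" and x: "x \<in> K"
  shows "poly_op (pCons a p) T x = a *\<^sub>C x + T (poly_op p T x)"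
proof (cases "p = 0")
  case False
  have "T (poly_op p T x) = (\<Sum>i\<le>degree p. coeff p i *\<^sub>C T ((T ^^ i) x))"
    unfolding poly_op_def
    by (subst op_sum[OF T])
       (auto simp: scaleC_in funpow_in[OF T x] bounded_op_on_scaleC[OF T])
  then show ?thesis
    using False by (simp add: poly_op_def sum.atMost_Suc_shift del: sum.atMost_Suc)
qed (simp add: poly_op_def op_zero[OF T])

lemma poly_op_in: "bounded_op_on K T \<Longrightarrow> x \<in> K \<Longrightarrow> poly_op p T x \<in> K"
  by (induction p) (auto simp: zero_in poly_op_pCons add_in scaleC_in bounded_op_on_in)

lemma bounded_op_on_poly_op:
  assumes T: "bounded_op_on K T"
  shows "bounded_op_on K (poly_op p T)"
proof (induction p)
  case 0
  show ?case
    using bounded_op_on_lincomb[OF T T, of 0 0] by (simp add: bounded_op_on_def)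
next
  case (pCons a p)
  have "bounded_op_on K (\<lambda>x. a *\<^sub>C x + 1 *\<^sub>C T (poly_op p T x))"
    by (intro bounded_op_on_lincomb bounded_op_on_ident bounded_op_on_comp[OF T] pCons)
  then show ?case
    using bounded_op_on_cong[OF _ sub] poly_op_pCons[OF T] by (metis (no_types, lifting) scaleC_one)
qed

context
  fixes T assumes T: "bounded_op_on K T"
begin

lemma poly_op_add: "x \<in> K \<Longrightarrow> poly_op (p + q) T x = poly_op p T x + poly_op q T x"
  by (induction p q rule: poly_induct2)
     (auto simp: poly_op_pCons[OF T] scaleC_add_left bounded_op_on_add[OF T] poly_op_in[OF T])

lemma poly_op_smult: "x \<in> K \<Longrightarrow> poly_op (smult c p) T x = c *\<^sub>C poly_op p T x"
  by (induction p)
     (auto simp: poly_op_pCons[OF T] scaleC_add_right scaleC_scaleC bounded_op_on_scaleC[OF T] poly_op_in[OF T])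

lemma poly_op_diff: "x \<in> K \<Longrightarrow> poly_op (p - q) T x = poly_op p T x - poly_op q T x"
  using poly_op_add[of x p "smult (-1) q"] poly_op_smult[of x "-1" q] by (simp add: scaleC_minus_one)

lemma poly_op_const: "x \<in> K \<Longrightarrow> poly_op [:a:] T x = a *\<^sub>C x"
  by (simp add: poly_op_pCons[OF T] op_zero[OF T])

lemma poly_op_mult: "x \<in> K \<Longrightarrow> poly_op (p * q) T x = poly_op p T (poly_op q T x)"
  by (induction p)
     (auto simp: poly_op_pCons[OF T] poly_op_in[OF T] poly_op_add poly_op_smult)

text \<open>One half of the spectral mapping theorem. Each root \<open>z\<close> of \<open>p\<close>
  lies off the spectrum, so the factor \<open>T - z\<close> is invertible, and the remaining factor
  has smaller degree.\<close>

lemma invertible_on_poly_op: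
  "p \<noteq> 0 \<Longrightarrow> (\<And>z. z \<in> spectrum_on K T \<Longrightarrow> poly p z \<noteq> 0) \<Longrightarrow> invertible_on K (poly_op p T)"
proof (induction "degree p" arbitrary: p)
  case 0
  then obtain a where a: "p = [:a:]" "a \<noteq> 0"
    by (metis degree_eq_zeroE pCons_0_0)
  have "bounded_op_on K (\<lambda>x. (1 / a) *\<^sub>C x)"
    using bounded_op_on_lincomb[OF bounded_op_on_ident bounded_op_on_ident, of "1 / a" 0] by simp
  then show ?case
    unfolding invertible_on_def
    by (intro exI[of _ "\<lambda>x. (1 / a) *\<^sub>C x"])
       (use a in \<open>simp add: poly_op_const scaleC_in scaleC_scaleC\<close>)
next
  case (Suc n)
  then have "\<not> constant (poly p)" by (simp add: constant_degree)
  then obtain z where z: "poly p z = 0" using fundamental_theorem_of_algebra by blast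
  then obtain q where q: "p = [:-z, 1:] * q" by (auto simp: poly_eq_0_iff_dvd)
  have "q \<noteq> 0" using q Suc.prems by auto
  then have "degree p = Suc (degree q)"
    unfolding q by (subst degree_mult_eq) auto
  then have "degree q = n" using Suc.hyps by simp
  moreover have "poly q w \<noteq> 0" if "w \<in> spectrum_on K T" for w
    using Suc.prems(2)[OF that] q by auto
  ultimately have iq: "invertible_on K (poly_op q T)"
    using Suc.hyps(1) \<open>q \<noteq> 0\<close> by blast
  have "invertible_on K (\<lambda>x. T x - z *\<^sub>C x)"
    using Suc.prems(2) z spectrum_on_iff by blast
  moreover have "bounded_op_on K (\<lambda>x. T x - z *\<^sub>C x)"
    using bounded_op_on_lincomb[OF T bounded_op_on_ident, of 1 "-z"] by (simp add: scaleC_minus_left)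
  ultimately have "invertible_on K (\<lambda>x. T (poly_op q T x) - z *\<^sub>C poly_op q T x)"
    using invertible_on_comp[OF _ iq bounded_op_on_poly_op[OF T]] by blast
  moreover have "poly_op p T x = T (poly_op q T x) - z *\<^sub>C poly_op q T x" if "x \<in> K" for x
  proof -
    have "poly_op p T x = poly_op [:-z, 1:] T (poly_op q T x)"
      unfolding q using that by (rule poly_op_mult)
    then show ?thesis
      using poly_op_in[OF T that, of q]
      by (simp add: poly_op_pCons[OF T] op_zero[OF T] scaleC_minus_left)
  qed
  ultimately show ?case
    unfolding invertible_on_def by (metis (no_types, lifting) bounded_op_on_in)
qed

end

text \<open>Symmetry moves one factor \<open>T\<close> across per induction step; it arrives to the
  right of the remaining polynomial and has to be commuted past it.\<close>

lemma poly_op_cinner: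
  assumes T: "psd_on K T" and x: "x \<in> K" and y: "y \<in> K"
  shows "cinner (poly_op p T x) y = cinner x (poly_op (map_poly cnj p) T y)"
proof -
  have bT: "bounded_op_on K T" using T by (simp add: psd_on_def)
  show ?thesis
    using x y
  proof (induction p arbitrary: x y)
    case (pCons a p)
    have "poly_op p T x \<in> K" "T y \<in> K" "poly_op (map_poly cnj p) T y \<in> K"
      using pCons.prems poly_op_in[OF bT] bounded_op_on_in[OF bT] by auto
    \<comment> \<open>Both sides evaluate the commutative product of \<open>q\<close> and
      \<open>[:0, 1:]\<close> at \<open>T\<close>.\<close>
    moreover have "poly_op q T (T y) = T (poly_op q T y)" for q
      using poly_op_mult[OF bT pCons.prems(2), of q "[:0, 1:]"]
        poly_op_mult[OF bT pCons.prems(2), of "[:0, 1:]" q] pCons.prems(2) poly_op_in[OF bT pCons.prems(2), of q]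
      by (simp add: poly_op_pCons[OF bT] op_zero[OF bT] mult.commute)
    ultimately show ?case
      using pCons T by (simp add: poly_op_pCons[OF bT] cinner_simps psd_on_def map_poly_pCons)
  qed simp
qed

text \<open>
  With \<open>N = \<parallel>p(T)\<parallel>\<close> the positive operator \<open>N\<^sup>2 - p(T)\<^sup>* p(T)\<close> is not coercive, hence not invertible,
  so the polynomial it comes from vanishes somewhere on the spectrum.
\<close>

lemma norm_poly_op_root:
  fixes p :: "complex poly"
  assumes T: "psd_on K T" and x0: "x0 \<in> K" "x0 \<noteq> 0"
  defines "r \<equiv> [:of_real ((onorm_on K (poly_op p T))\<^sup>2):] - map_poly cnj p * p"
  assumes "r \<noteq> 0"
  shows "\<exists>z\<in>spectrum_on K T. poly r z = 0"
proof (rule ccontr)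
  assume neg: "\<not> ?thesis"
  have bT: "bounded_op_on K T" using T by (simp add: psd_on_def)
  define N where "N = onorm_on K (poly_op p T)"
  have N: "norm (poly_op p T x) \<le> N * norm x" if "x \<in> K" for x
    unfolding N_def using bounded_op_on_poly_op[OF bT] that by (rule norm_le_onorm_on)
  have N0: "N \<ge> 0" unfolding N_def using bounded_op_on_poly_op[OF bT] by (rule onorm_on_nonneg)
  have S: "poly_op r T x = of_real (N\<^sup>2) *\<^sub>C x - poly_op (map_poly cnj p) T (poly_op p T x)"
    if "x \<in> K" for x
    unfolding r_def N_def[symmetric]
    using that by (simp add: poly_op_diff[OF bT] poly_op_const[OF bT] poly_op_mult[OF bT])
  have adj: "cinner (poly_op (map_poly cnj p) T u) v = cinner u (poly_op p T v)"
    if "u \<in> K" "v \<in> K" for u v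
    using poly_op_cinner[OF T that(2,1), of p] cinner_commute by metis
  have form: "cinner (poly_op r T x) y = of_real (N\<^sup>2) * cinner x y - cinner (poly_op p T x) (poly_op p T y)"
    if "x \<in> K" "y \<in> K" for x y
    using that by (simp add: S cinner_simps adj poly_op_in[OF bT])
  have "psd_on K (poly_op r T)"
    unfolding psd_on_def
  proof (intro conjI ballI)
    show "bounded_op_on K (poly_op r T)" using bT by (rule bounded_op_on_poly_op)
  next
    fix x y assume "x \<in> K" "y \<in> K"
    then show "cinner (poly_op r T x) y = cinner x (poly_op r T y)"
      using cinner_commute[of x "poly_op r T y"] cinner_commute[of x y]
        cinner_commute[of "poly_op p T x" "poly_op p T y"]
      by (simp add: form)
  next
    fix x assume x: "x \<in> K"
    have "(norm (poly_op p T x))\<^sup>2 \<le> (N * norm x)\<^sup>2"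
      using N[OF x] by (intro power_mono) auto
    then show "0 \<le> Re (cinner (poly_op r T x) x)"
      using form[OF x x] by (simp add: Re_cinner_self cinner_self power_mult_distrib)
  qed
  moreover have "invertible_on K (poly_op r T)"
    using bT \<open>r \<noteq> 0\<close> neg by (intro invertible_on_poly_op) auto
  ultimately obtain e where e: "e > 0" "\<And>x. x \<in> K \<Longrightarrow> e * (norm x)\<^sup>2 \<le> Re (cinner (poly_op r T x) x)"
    using psd_on_invertible_imp_coercive by blast
  have sq: "(norm (poly_op p T x))\<^sup>2 \<le> (N\<^sup>2 - e) * (norm x)\<^sup>2" if "x \<in> K" for x
    using e(2)[OF that] form[OF that that] by (simp add: cinner_self algebra_simps)
  \<comment> \<open>The vector \<open>x0\<close> ensures that \<open>N\<^sup>2 - e\<close> is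
    nonnegative, so that its square root is an admissible bound, smaller than the least one
    \<open>N\<close>. On the zero space this could fail.\<close>
  have nn: "0 \<le> (N\<^sup>2 - e) * (norm x0)\<^sup>2"
    by (rule order_trans[OF zero_le_power2 sq[OF x0(1)]])
  have Ne: "0 \<le> N\<^sup>2 - e"
  proof (rule ccontr)
    assume "\<not> 0 \<le> N\<^sup>2 - e"
    then have "(N\<^sup>2 - e) * (norm x0)\<^sup>2 < 0"
      using x0(2) by (intro mult_neg_pos) simp_all
    with nn show False by (rule leD[THEN notE])
  qed
  have "N \<le> sqrt (N\<^sup>2 - e)"
    unfolding N_def
  proof (rule onorm_on_le)
    fix x assume x: "x \<in> K"
    show "norm (poly_op p T x) \<le> sqrt ((onorm_on K (poly_op p T))\<^sup>2 - e) * norm x"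
      using sq[OF x] Ne unfolding N_def
      by (intro power2_le_imp_le[OF _ mult_nonneg_nonneg]) (simp_all add: power_mult_distrib)
  next
    show "0 \<le> sqrt ((onorm_on K (poly_op p T))\<^sup>2 - e)"
      using Ne unfolding N_def by simp
  qed
  from power_mono[OF this N0, of 2] have "N\<^sup>2 \<le> N\<^sup>2 - e"
    using Ne by simp
  then show False using e(1) by simp
qed

lemma spectrum_on_psd_nonempty:
  assumes T: "psd_on K T" and x0: "x0 \<in> K" "x0 \<noteq> 0"
  shows "spectrum_on K T \<noteq> {}"
proof -
  define N where "N = onorm_on K (poly_op [:0, 1:] T)"
  \<comment> \<open>The value at this point is \<open>2 * N\<^sup>2 - 1 + 2 * \<i> * N\<close>,
    nonzero for every real \<open>N\<close>.\<close>
  have "poly ([:complex_of_real (N\<^sup>2):] - map_poly cnj [:0, 1:] * [:0, 1:]) (\<i> * (of_real N + \<i>)) \<noteq> 0"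
    by (auto simp: complex_eq_iff power2_eq_square algebra_simps add_nonneg_eq_0_iff map_poly_pCons)
  then have "[:complex_of_real (N\<^sup>2):] - map_poly cnj [:0, 1:] * [:0, 1:] \<noteq> 0"
    by (metis poly_0)
  then show ?thesis
    using norm_poly_op_root[OF T x0, of "[:0, 1:]"] by (auto simp: N_def)
qed

text \<open>The spectrum is real, so at a root \<open>z\<close> supplied by
  \<open>norm_poly_op_root\<close> the polynomial with conjugated coefficients takes the value
  \<open>cnj (poly p z)\<close>. Hence the norm of \<open>p(T)\<close> equals
  \<open>cmod (poly p z)\<close> at a point of the spectrum.\<close>

lemma norm_poly_op_le:
  assumes T: "psd_on K T" and M: "\<And>z. z \<in> spectrum_on K T \<Longrightarrow> cmod (poly p z) \<le> M"
    and x: "x \<in> K"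
  shows "norm (poly_op p T x) \<le> M * norm x"
proof (cases "x = 0")
  case True
  have "bounded_op_on K T" using T by (simp add: psd_on_def)
  then show ?thesis using True op_zero[OF bounded_op_on_poly_op] by simp
next
  case False
  have bT: "bounded_op_on K T" using T by (simp add: psd_on_def)
  define N where "N = onorm_on K (poly_op p T)"
  have N0: "N \<ge> 0" unfolding N_def using bounded_op_on_poly_op[OF bT] by (rule onorm_on_nonneg)
  obtain L where L: "\<And>x. x \<in> K \<Longrightarrow> norm (T x) \<le> L * norm x"
    using bounded_op_on_pos_bound[OF bT] by metis
  \<comment> \<open>If the polynomial vanishes identically, every point of the spectrum is a root;
    here the spectrum must be known to be nonempty.\<close>
  obtain z where z: "z \<in> spectrum_on K T" "poly ([:of_real (N\<^sup>2):] - map_poly cnj p * p) z = 0"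
    using norm_poly_op_root[OF T x False, of p] spectrum_on_psd_nonempty[OF T x False]
    unfolding N_def by (metis all_not_in_conv poly_0)
  obtain t where t: "z = of_real t" using spectrum_on_psd[OF T L z(1)] by blast
  have "complex_of_real (N\<^sup>2) = cnj (poly p z) * poly p z"
    using z(2) by (simp add: t)
  also have "\<dots> = of_real ((cmod (poly p z))\<^sup>2)"
    by (metis complex_norm_square mult.commute)
  finally have "N = cmod (poly p z)"
    using N0 by (metis of_real_eq_iff norm_ge_zero power2_eq_iff_nonneg)
  then have "N \<le> M" using M[OF z(1)] by simp
  then show ?thesis
    using norm_le_onorm_on[OF bounded_op_on_poly_op[OF bT] x, of p] mult_right_mono[of N M "norm x"]
    unfolding N_def by simp
qed

end


section \<open>Real powers of a positive operator\<close>

text \<open>The graph of the convex power lies above its tangent at \<open>s\<close>; for positive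
  arguments this is Young's inequality rearranged.\<close>

lemma powr_above_tangent:
  fixes r s t :: real
  assumes "r \<ge> 1" "s \<ge> 0" "t \<ge> 0"
  shows "s powr r + r * s powr (r - 1) * (t - s) \<le> t powr r"
proof -
  consider "s = 0" | "s > 0" "t = 0" | "s > 0" "t > 0" using assms by linarith
  then show ?thesis
  proof cases
    case 1
    \<comment> \<open>\<open>0 powr (r - 1)\<close> is 0 even for \<open>r = 1\<close>, so the left
      side vanishes.\<close>
    then show ?thesis using assms by simp
  next
    case 2
    have "s powr r = s powr (r - 1) * s"
      using 2 by (simp add: powr_diff)
    then have "s powr r + r * s powr (r - 1) * (t - s) = (1 - r) * s powr r"
      using 2 by (simp add: algebra_simps)
    also have "\<dots> \<le> 0" using assms by (simp add: mult_nonpos_nonneg)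
    finally show ?thesis by (simp add: 2)
  next
    case 3
    have "(t powr r) powr (1 / r) * (s powr r) powr (1 - 1 / r) \<le> 1 / r * t powr r + (1 - 1 / r) * s powr r"
      by (rule Youngs_inequality_0) (use assms 3 in auto)
    moreover have "(t powr r) powr (1 / r) = t" "r * (1 - 1 / r) = r - 1"
      using assms 3 by (auto simp: powr_powr field_simps)
    ultimately have "t * s powr (r - 1) \<le> 1 / r * t powr r + (1 - 1 / r) * s powr r"
      by (simp add: powr_powr)
    then have "r * (t * s powr (r - 1)) \<le> r * (1 / r * t powr r + (1 - 1 / r) * s powr r)"
      using assms by (intro mult_left_mono) auto
    also have "\<dots> = t powr r + (r - 1) * s powr r"
      using assms by (simp add: field_simps)
    also have "s powr r = s powr (r - 1) * s"
      using 3 by (simp add: powr_diff)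
    finally have "r * (t * s powr (r - 1)) \<le> t powr r + (r - 1) * (s powr (r - 1) * s)" .
    moreover have "s powr r = s powr (r - 1) * s"
      using 3 by (simp add: powr_diff)
    ultimately show ?thesis by (simp add: algebra_simps)
  qed
qed

text \<open>In the sum of the tangent inequalities from the midpoint to \<open>a\<close> and to
  \<open>b\<close> the linear terms cancel.\<close>

lemma powr_midpoint_le:
  fixes a b p :: real
  assumes "p \<ge> 1" "a \<ge> 0" "b \<ge> 0"
  shows "((a + b) / 2) powr p \<le> (a powr p + b powr p) / 2"
  using powr_above_tangent[of p "(a + b) / 2" a] powr_above_tangent[of p "(a + b) / 2" b] assms
  by (simp add: field_simps)

lemma Weierstrass_complex_poly:
  fixes f :: "real \<Rightarrow> real"
  assumes "continuous_on {a..b} f" "e > 0"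
  shows "\<exists>p :: complex poly. \<forall>t\<in>{a..b}. cmod (poly p (of_real t) - of_real (f t)) < e"
proof -
  obtain g where g: "real_polynomial_function g" "\<And>t. t \<in> {a..b} \<Longrightarrow> \<bar>f t - g t\<bar> < e"
    using Stone_Weierstrass_real_polynomial_function[OF compact_Icc assms] by blast
  obtain c n where c: "g = (\<lambda>x. \<Sum>i\<le>n. c i * x ^ i)"
    using g(1) by (auto simp: real_polynomial_function_iff_sum)
  define p where "p = (\<Sum>i\<le>n. monom (complex_of_real (c i)) i)"
  have "poly p (of_real t) = of_real (g t)" for t
    by (simp add: p_def c poly_sum poly_monom)
  then have "cmod (poly p (of_real t) - of_real (f t)) = \<bar>f t - g t\<bar>" for t
    by (simp flip: of_real_diff add: abs_minus_commute)
  then show ?thesis using g(2) by (intro exI[of _ p]) simp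
qed

lemma Cauchy_inverse_Suc:
  fixes f :: "nat \<Rightarrow> 'a::real_normed_vector"
  assumes f: "\<And>m n. norm (f m - f n) \<le> (inverse (real (Suc m)) + inverse (real (Suc n))) * C"
    and C: "C \<ge> 0"
  shows "Cauchy f"
  unfolding Cauchy_def
proof (intro allI impI)
  fix e :: real assume e: "e > 0"
  define d where "d = e / (C + 1)"
  have "d > 0" using e C by (simp add: d_def)
  then obtain N where N: "inverse (real (Suc N)) < d / 2"
    using reals_Archimedean[of "d / 2"] by auto
  show "\<exists>M. \<forall>m\<ge>M. \<forall>n\<ge>M. dist (f m) (f n) < e"
  proof (intro exI allI impI)
    fix m n assume "N \<le> m" "N \<le> n"
    then have "inverse (real (Suc m)) \<le> inverse (real (Suc N))"
      "inverse (real (Suc n)) \<le> inverse (real (Suc N))" by (auto intro: le_imp_inverse_le)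
    then have "inverse (real (Suc m)) + inverse (real (Suc n)) \<le> d"
      using N by linarith
    then have "(inverse (real (Suc m)) + inverse (real (Suc n))) * C \<le> d * C"
      using C by (rule mult_right_mono)
    also have "\<dots> < e" using C e by (simp add: d_def field_simps)
    finally show "dist (f m) (f n) < e" using f[of m n] by (simp add: dist_norm)
  qed
qed

context closed_csubspace
begin

section \<open>The functional calculus for powers\<close>

lemma bounded_op_on_tendsto:
  assumes T: "bounded_op_on K T" and u: "\<And>n. u n \<in> K" "u \<longlonglongrightarrow> x" and x: "x \<in> K"
  shows "(\<lambda>n. T (u n)) \<longlonglongrightarrow> T x"
proof -
  obtain M where M: "M > 0" "\<And>x. x \<in> K \<Longrightarrow> norm (T x) \<le> M * norm x"
    using bounded_op_on_pos_bound[OF T] by metis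
  have bound: "norm (T (u n) - T x) \<le> M * norm (u n - x)" for n
    using M(2)[OF diff_in[OF u(1) x]] by (simp add: op_diff[OF T u(1) x])
  have "(\<lambda>n. u n - x) \<longlonglongrightarrow> 0" using u(2) by (rule LIM_zero)
  then have "(\<lambda>n. M * norm (u n - x)) \<longlonglongrightarrow> 0"
    by (intro tendsto_mult_right_zero tendsto_norm_zero)
  then have "(\<lambda>n. T (u n) - T x) \<longlonglongrightarrow> 0"
    by (rule Lim_null_comparison[rotated]) (simp add: bound)
  then show ?thesis by (rule LIM_zero_cancel)
qed

text \<open>A witness for the choice in \<open>fun_calc_on\<close> is the pointwise limit
  \<open>Q\<close> of \<open>p n\<close> at \<open>T\<close>, where \<open>p n\<close> approximates
  the power on all of \<open>{0..L}\<close> and so on the spectrum. The second claim lets quadratic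
  forms of the power be computed as limits.\<close>

lemma rpower_on_approx:
  assumes T: "psd_on K T" and r: "r \<ge> 1" and L: "\<And>x. x \<in> K \<Longrightarrow> norm (T x) \<le> L * norm x"
  shows "bounded_op_on K (rpower_on K T r)" (is ?thesis1)
    and "\<exists>p. (\<forall>n. \<forall>t\<in>{0..L}. cmod (poly (p n) (of_real t) - of_real (t powr r)) < inverse (real (Suc n))) \<and>
      (\<forall>x\<in>K. (\<lambda>n. poly_op (p n) T x) \<longlonglongrightarrow> rpower_on K T r x)" (is ?thesis2)
proof -
  have bT: "bounded_op_on K T" using T by (simp add: psd_on_def)
  define f :: "complex \<Rightarrow> complex" where "f z = z powr of_real r" for z
  define Sp where "Sp = spectrum_on K T"
  have "\<exists>p :: complex poly. \<forall>t\<in>{0..L}. cmod (poly p (of_real t) - of_real (t powr r)) < inverse (real (Suc n))" for n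
  proof (rule Weierstrass_complex_poly)
    show "continuous_on {0..L} (\<lambda>t. t powr r)"
      using r by (intro continuous_on_powr' continuous_intros) auto
  qed simp
  then obtain p :: "nat \<Rightarrow> complex poly"
    where p: "\<And>n t. t \<in> {0..L} \<Longrightarrow> cmod (poly (p n) (of_real t) - of_real (t powr r)) < inverse (real (Suc n))"
    by metis
  have pS: "cmod (poly (p n) z - f z) < inverse (real (Suc n))" if z: "z \<in> Sp" for n z
  proof -
    obtain t where t: "t \<in> {0..L}" "z = of_real t"
      using spectrum_on_psd[OF T L] z unfolding Sp_def by blast
    then show ?thesis using p[OF t(1)] by (simp add: f_def powr_of_real)
  qed
  define P where "P n = poly_op (p n) T" for n
  \<comment> \<open>Stated for an arbitrary polynomial \<open>q\<close>: with \<open>q = p m\<close>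
    it makes the sequence Cauchy, and in the limit it shows that every admissible sequence converges
    to \<open>Q\<close>.\<close>
  have D: "norm (poly_op q T x - P n x) \<le> (d + inverse (real (Suc n))) * norm x"
    if "\<And>z. z \<in> Sp \<Longrightarrow> cmod (poly q z - f z) \<le> d" "x \<in> K" for q d n x
  proof -
    have "cmod (poly (q - p n) z) \<le> d + inverse (real (Suc n))" if "z \<in> spectrum_on K T" for z
    proof -
      have z: "z \<in> Sp" using that by (simp add: Sp_def)
      have "poly (q - p n) z = (poly q z - f z) - (poly (p n) z - f z)" by simp
      then have "cmod (poly (q - p n) z) \<le> cmod (poly q z - f z) + cmod (poly (p n) z - f z)"
        by (metis norm_triangle_ineq4)
      then show ?thesis
        using pS[OF z, of n] \<open>\<And>z. z \<in> Sp \<Longrightarrow> cmod (poly q z - f z) \<le> d\<close>[OF z] by linarith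
    qed
    from norm_poly_op_le[OF T this that(2)] show ?thesis
      using that(2) by (simp add: P_def poly_op_diff[OF bT])
  qed
  have bP: "bounded_op_on K (P n)" for n
    unfolding P_def using bT by (rule bounded_op_on_poly_op)
  have "\<exists>l. (\<lambda>n. P n x) \<longlonglongrightarrow> l" if "x \<in> K" for x
  proof -
    have "norm (P m x - P n x) \<le> (inverse (real (Suc m)) + inverse (real (Suc n))) * norm x" for m n
      using D[OF less_imp_le[OF pS] that, of m n] by (simp only: P_def)
    then have "Cauchy (\<lambda>n. P n x)" by (rule Cauchy_inverse_Suc) simp
    then show ?thesis using Cauchy_convergent_iff convergent_def by blast
  qed
  then obtain Q where Q: "\<And>x. x \<in> K \<Longrightarrow> (\<lambda>n. P n x) \<longlonglongrightarrow> Q x"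
    by metis
  have DQ: "norm (poly_op q T x - Q x) \<le> d * norm x"
    if q: "\<And>z. z \<in> Sp \<Longrightarrow> cmod (poly q z - f z) \<le> d" and x: "x \<in> K" for q d x
  proof (rule LIMSEQ_le)
    show "(\<lambda>n. norm (poly_op q T x - P n x)) \<longlonglongrightarrow> norm (poly_op q T x - Q x)"
      by (intro tendsto_intros Q x)
    show "(\<lambda>n. (d + inverse (real (Suc n))) * norm x) \<longlonglongrightarrow> d * norm x"
      using tendsto_mult[OF tendsto_add[OF tendsto_const LIMSEQ_inverse_real_of_nat] tendsto_const, of d "norm x"]
      by simp
    show "\<exists>N. \<forall>n\<ge>N. norm (poly_op q T x - P n x) \<le> (d + inverse (real (Suc n))) * norm x"
      using D[OF q x] by blast
  qed
  have bQ: "bounded_op_on K Q"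
  proof -
    obtain M where M: "\<And>x. x \<in> K \<Longrightarrow> norm (P 0 x) \<le> M * norm x"
      using bounded_op_on_pos_bound[OF bP] by metis
    show ?thesis
    proof (rule bounded_op_onI[where M = "M + 1"])
      show "Q x \<in> K" if "x \<in> K" for x
        using closed_sequentially[OF clo _ Q[OF that]] bounded_op_on_in[OF bP that] by blast
      show "Q (x + y) = Q x + Q y" if "x \<in> K" "y \<in> K" for x y
      proof (rule LIMSEQ_unique)
        show "(\<lambda>n. P n (x + y)) \<longlonglongrightarrow> Q (x + y)" by (rule Q[OF add_in[OF that]])
        show "(\<lambda>n. P n (x + y)) \<longlonglongrightarrow> Q x + Q y"
          using tendsto_add[OF Q[OF that(1)] Q[OF that(2)]]
          by (simp add: bounded_op_on_add[OF bP that])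
      qed
      show "Q (c *\<^sub>C x) = c *\<^sub>C Q x" if "x \<in> K" for c x
      proof (rule LIMSEQ_unique)
        show "(\<lambda>n. P n (c *\<^sub>C x)) \<longlonglongrightarrow> Q (c *\<^sub>C x)" by (rule Q[OF scaleC_in[OF that]])
        show "(\<lambda>n. P n (c *\<^sub>C x)) \<longlonglongrightarrow> c *\<^sub>C Q x"
          using bounded_linear.tendsto[OF bounded_linear_scaleC Q[OF that], of c]
          by (simp add: bounded_op_on_scaleC[OF bP that])
      qed
      show "norm (Q x) \<le> (M + 1) * norm x" if x: "x \<in> K" for x
      proof -
        have "norm (P 0 x - Q x) \<le> 1 * norm x"
          unfolding P_def using pS[of _ 0] x by (intro DQ) (auto intro: less_imp_le)
        moreover have "norm (Q x) \<le> norm (P 0 x) + norm (P 0 x - Q x)"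
          using norm_triangle_sub[of "Q x" "P 0 x"] by (simp add: norm_minus_commute)
        ultimately show ?thesis using M[OF x] by (simp add: algebra_simps)
      qed
    qed
  qed
  have uQ: "(\<lambda>n. onorm_on K (\<lambda>x. poly_op (q n) T x - Q x)) \<longlonglongrightarrow> 0"
    if q: "uniform_limit Sp (\<lambda>n z. poly (q n) z) f sequentially" for q
  proof (rule tendstoI)
    fix e :: real assume e: "e > 0"
    then have "e / 2 > 0" by simp
    then have "\<forall>\<^sub>F n in sequentially. \<forall>z\<in>Sp. dist (poly (q n) z) (f z) < e / 2"
      using q unfolding uniform_limit_iff by blast
    then show "\<forall>\<^sub>F n in sequentially. dist (onorm_on K (\<lambda>x. poly_op (q n) T x - Q x)) 0 < e"
    proof eventually_elim
      case (elim n)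
      have "onorm_on K (\<lambda>x. poly_op (q n) T x - Q x) \<le> e / 2"
      proof (rule onorm_on_le)
        show "norm (poly_op (q n) T x - Q x) \<le> e / 2 * norm x" if "x \<in> K" for x
          using elim that by (intro DQ) (auto simp: dist_norm less_imp_le)
      qed (use e in simp)
      moreover have "0 \<le> onorm_on K (\<lambda>x. poly_op (q n) T x - Q x)"
        by (rule onorm_on_nonneg[OF bounded_op_on_diff[OF bounded_op_on_poly_op[OF bT] bQ]])
      ultimately show ?case using e by simp
    qed
  qed
  have "\<exists>P. bounded_op_on K P \<and> (\<forall>q. uniform_limit (spectrum_on K T) (\<lambda>n z. poly (q n) z) f sequentially \<longrightarrow>
         (\<lambda>n. onorm_on K (\<lambda>x. poly_op (q n) T x - P x)) \<longlonglongrightarrow> 0)"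
    using bQ uQ unfolding Sp_def by blast
  from someI_ex[OF this]
  have R: "bounded_op_on K (rpower_on K T r)"
    "\<And>q. uniform_limit Sp (\<lambda>n z. poly (q n) z) f sequentially \<Longrightarrow>
       (\<lambda>n. onorm_on K (\<lambda>x. poly_op (q n) T x - rpower_on K T r x)) \<longlonglongrightarrow> 0"
    unfolding rpower_on_def fun_calc_on_def f_def Sp_def by blast+
  show ?thesis1 by (rule R(1))
  \<comment> \<open>The chosen operator is reached through its own property, applied to the sequence
    \<open>p\<close>.\<close>
  have "uniform_limit Sp (\<lambda>n z. poly (p n) z) f sequentially"
    unfolding uniform_limit_iff
  proof (intro allI impI)
    fix e :: real assume "e > 0"
    then obtain N where N: "inverse (real (Suc N)) < e" using reals_Archimedean by blast
    have "\<forall>z\<in>Sp. dist (poly (p n) z) (f z) < e" if "n \<ge> N" for n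
    proof
      fix z assume "z \<in> Sp"
      have "inverse (real (Suc n)) \<le> inverse (real (Suc N))"
        using that by (auto intro: le_imp_inverse_le)
      then show "dist (poly (p n) z) (f z) < e"
        using pS[OF \<open>z \<in> Sp\<close>, of n] N unfolding dist_norm by linarith
    qed
    then show "\<forall>\<^sub>F n in sequentially. \<forall>z\<in>Sp. dist (poly (p n) z) (f z) < e"
      by (rule eventually_sequentiallyI)
  qed
  note lim = R(2)[OF this]
  have "(\<lambda>n. poly_op (p n) T x) \<longlonglongrightarrow> rpower_on K T r x" if x: "x \<in> K" for x
  proof -
    have bound: "norm (poly_op (p n) T x - rpower_on K T r x) \<le>
        onorm_on K (\<lambda>x. poly_op (p n) T x - rpower_on K T r x) * norm x" for n
      by (rule norm_le_onorm_on[OF bounded_op_on_diff[OF bounded_op_on_poly_op[OF bT] R(1)] x])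
    have "(\<lambda>n. onorm_on K (\<lambda>x. poly_op (p n) T x - rpower_on K T r x) * norm x) \<longlonglongrightarrow> 0"
      using lim by (rule tendsto_mult_left_zero)
    then have "(\<lambda>n. poly_op (p n) T x - rpower_on K T r x) \<longlonglongrightarrow> 0"
      by (rule Lim_null_comparison[rotated]) (simp only: bound eventually_True)
    then show ?thesis by (rule LIM_zero_cancel)
  qed
  then show ?thesis2 using p by blast
qed

text \<open>
  For unit \<open>x\<close> and \<open>s = \<langle>T x, x\<rangle>\<close> this is McCarthy's inequality \<open>\<langle>T x, x\<rangle>\<^sup>r \<le> \<langle>T\<^sup>r x, x\<rangle>\<close>;
  the form with a free \<open>s\<close> can be added over the summands of a block diagonal operator.
\<close>

lemma rpower_on_above_tangent:
  assumes T: "psd_on K T" and r: "r \<ge> 1" and s: "s \<ge> 0" and x: "x \<in> K"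
  shows "s powr r * (norm x)\<^sup>2 + r * s powr (r - 1) * (Re (cinner (T x) x) - s * (norm x)\<^sup>2)
    \<le> Re (cinner (rpower_on K T r x) x)"
proof -
  have bT: "bounded_op_on K T" using T by (simp add: psd_on_def)
  obtain L where L: "L > 0" "\<And>x. x \<in> K \<Longrightarrow> norm (T x) \<le> L * norm x"
    using bounded_op_on_pos_bound[OF bT] by metis
  obtain p where p: "\<And>n t. t \<in> {0..L} \<Longrightarrow> cmod (poly (p n) (of_real t) - of_real (t powr r)) < inverse (real (Suc n))"
    and lim: "(\<lambda>n. poly_op (p n) T x) \<longlonglongrightarrow> rpower_on K T r x"
    using rpower_on_approx(2)[OF T r L(2)] x by blast
  \<comment> \<open>The tangent at \<open>s\<close> is \<open>a + c * t\<close>, and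
    \<open>B\<close> bounds the height of the power above it on \<open>{0..L}\<close>.\<close>
  define c where "c = r * s powr (r - 1)"
  define a where "a = s powr r - c * s"
  define B where "B = L powr r + c * s"
  have c0: "c \<ge> 0" using r by (simp add: c_def)
  have fB: "0 \<le> t powr r - (a + c * t)" "t powr r - (a + c * t) \<le> B" if t: "t \<in> {0..L}" for t
  proof -
    show "0 \<le> t powr r - (a + c * t)"
      using powr_above_tangent[OF r s, of t] t by (simp add: a_def c_def algebra_simps)
    have "t powr r \<le> L powr r" using t r by (intro powr_mono2) auto
    moreover have "0 \<le> c * t" using c0 t by simp
    moreover have "0 \<le> s powr r" by simp
    ultimately show "t powr r - (a + c * t) \<le> B" unfolding a_def B_def by linarith
  qed
  have low: "a * (norm x)\<^sup>2 + c * Re (cinner (T x) x) - inverse (real (Suc n)) * (norm x)\<^sup>2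
      \<le> Re (cinner (poly_op (p n) T x) x)" for n
  proof -
    \<comment> \<open>Subtracting \<open>B / 2\<close> centres the interval from 0 to
      \<open>B\<close>, in which the height above the tangent varies. The norm bound
      \<open>B / 2\<close> for the centred operator is then exactly the lower bound 0 for the form
      of the uncentred one, up to the approximation error.\<close>
    define q where "q = p n - [:of_real (a + B / 2), of_real c:]"
    have "cmod (poly q z) \<le> B / 2 + inverse (real (Suc n))" if z: "z \<in> spectrum_on K T" for z
    proof -
      obtain t where t: "t \<in> {0..L}" "z = of_real t"
        using spectrum_on_psd[OF T L(2) z] by blast
      have "poly q z = (poly (p n) (of_real t) - of_real (t powr r)) + of_real (t powr r - (a + c * t) - B / 2)"
        by (simp add: q_def t(2) algebra_simps)
      then have "cmod (poly q z) \<le> cmod (poly (p n) (of_real t) - of_real (t powr r)) + \<bar>t powr r - (a + c * t) - B / 2\<bar>"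
        by (metis norm_triangle_ineq norm_of_real)
      moreover have "\<bar>t powr r - (a + c * t) - B / 2\<bar> \<le> B / 2"
        using fB[OF t(1)] by linarith
      ultimately show ?thesis using p[OF t(1), of n] by linarith
    qed
    from norm_poly_op_le[OF T this x]
    have "norm (poly_op q T x) * norm x \<le> (B / 2 + inverse (real (Suc n))) * norm x * norm x"
      by (intro mult_right_mono) auto
    moreover have "- Re (cinner (poly_op q T x) x) \<le> norm (poly_op q T x) * norm x"
      using Re_cinner_le[of "- poly_op q T x" x] by (simp add: cinner_minus_left)
    moreover have "poly_op q T x = poly_op (p n) T x - (of_real (a + B / 2) *\<^sub>C x + of_real c *\<^sub>C T x)"
      using x bounded_op_on_in[OF bT x]
      by (simp add: q_def poly_op_diff[OF bT] poly_op_pCons[OF bT] op_zero[OF bT] bounded_op_on_scaleC[OF bT])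
    then have "Re (cinner (poly_op q T x) x) =
        Re (cinner (poly_op (p n) T x) x) - ((a + B / 2) * (norm x)\<^sup>2 + c * Re (cinner (T x) x))"
      by (simp add: cinner_simps cinner_self)
    ultimately show ?thesis by (simp add: algebra_simps power2_eq_square)
  qed
  have "a * (norm x)\<^sup>2 + c * Re (cinner (T x) x) \<le> Re (cinner (rpower_on K T r x) x)"
  proof (rule LIMSEQ_le)
    show "(\<lambda>n. Re (cinner (poly_op (p n) T x) x)) \<longlonglongrightarrow> Re (cinner (rpower_on K T r x) x)"
      by (intro tendsto_intros lim)
    show "(\<lambda>n. a * (norm x)\<^sup>2 + c * Re (cinner (T x) x) - inverse (real (Suc n)) * (norm x)\<^sup>2)
        \<longlonglongrightarrow> a * (norm x)\<^sup>2 + c * Re (cinner (T x) x)"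
      using tendsto_diff[OF tendsto_const tendsto_mult[OF LIMSEQ_inverse_real_of_nat tendsto_const],
          of "a * (norm x)\<^sup>2 + c * Re (cinner (T x) x)" "(norm x)\<^sup>2"] by simp
    show "\<exists>N. \<forall>n\<ge>N. a * (norm x)\<^sup>2 + c * Re (cinner (T x) x) - inverse (real (Suc n)) * (norm x)\<^sup>2
        \<le> Re (cinner (poly_op (p n) T x) x)"
      using low by blast
  qed
  then show ?thesis by (simp add: a_def c_def algebra_simps)
qed

end


section \<open>Operators induced on the completion\<close>

lemma hilbert_completionD:
  assumes "hilbert_completion A J"
  shows "J (x + y) = J x + J y" "J (c *\<^sub>C x) = c *\<^sub>C J x" "cinner (J x) (J y) = A_inner A x y"
  using assms by (auto simp: hilbert_completion_def)

lemma hilbert_completion_zero: "hilbert_completion A J \<Longrightarrow> J 0 = 0"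
  using hilbert_completionD(2)[of A J 0 0] by simp

lemma hilbert_completion_diff: "hilbert_completion A J \<Longrightarrow> J (x - y) = J x - J y"
  using hilbert_completionD(1)[of A J x "(-1) *\<^sub>C y"] hilbert_completionD(2)[of A J "-1" y]
  by (simp add: scaleC_minus_one)

lemma A_norm_eq_norm: "hilbert_completion A J \<Longrightarrow> A_norm A x = norm (J x)"
  unfolding A_norm_def using hilbert_completionD(3)[of A J x x, symmetric] by (simp add: cinner_self)

lemma A_inner_commute: "hilbert_completion A J \<Longrightarrow> A_inner A x y = cnj (A_inner A y x)"
  using cinner_commute[of "J x" "J y"] by (simp add: hilbert_completionD(3))

lemma closed_csubspace_completion:
  assumes J: "hilbert_completion A J"
  shows "closed_csubspace (closure (range J))"
proof
  have "csubspace (range J)"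
    by (rule csubspace_range[OF hilbert_completionD(1,2)[OF J]])
  then show "csubspace (closure (range J))" by (rule csubspace_closure)
qed simp

text \<open>
  Krein's argument: for the \<open>A\<close>-symmetric operator \<open>R = S T\<close> and \<open>\<parallel>x\<parallel>\<^sub>A = 1\<close>, iterating
  \<open>\<parallel>R x\<parallel>\<^sub>A\<^sup>2 \<le> \<parallel>R\<^sup>2 x\<parallel>\<^sub>A\<close> compares \<open>\<parallel>R x\<parallel>\<^sub>A\<close> with the growth rate of the ordinary norms \<open>\<parallel>R\<^sup>n x\<parallel>\<close>.
\<close>

lemma A_adjoint_imp_A_bounded:
  assumes J: "hilbert_completion A J" and A: "bounded_clinear A"
    and T: "bounded_clinear T" and S: "bounded_clinear S"
    and adj: "\<And>x y. A_inner A (T x) y = A_inner A x (S y)"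
  shows "\<exists>C\<ge>0. \<forall>x. norm (J (T x)) \<le> C * norm (J x)"
proof -
  define R where "R = S \<circ> T"
  have R: "bounded_clinear R" unfolding R_def by (rule bounded_clinear_comp[OF S T])
  obtain B where B: "B > 0" "\<And>x. norm (R x) \<le> norm x * B"
    using bounded_clinear_pos_bound[OF R] by blast
  obtain a where a: "a > 0" "\<And>x. norm (A x) \<le> norm x * a"
    using bounded_clinear_pos_bound[OF A] by blast
  have JT: "cinner (J (R x)) (J y) = cinner (J (T x)) (J (T y))"
    and TJ: "cinner (J x) (J (R y)) = cinner (J (T x)) (J (T y))" for x y
  proof -
    show 1: "cinner (J x) (J (R y)) = cinner (J (T x)) (J (T y))" for x y
      by (simp add: hilbert_completionD(3)[OF J] R_def adj)
    show "cinner (J (R x)) (J y) = cinner (J (T x)) (J (T y))"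
      using 1[of y x] cinner_commute[of "J (R x)" "J y"] cinner_commute[of "J (T x)" "J (T y)"] by simp
  qed
  have sym: "cinner (J ((R ^^ k) x)) (J y) = cinner (J x) (J ((R ^^ k) y))" for k x y
  proof (induction k arbitrary: y)
    case (Suc k)
    have "cinner (J ((R ^^ Suc k) x)) (J y) = cinner (J ((R ^^ k) x)) (J (R y))"
      by (simp add: JT TJ)
    also have "\<dots> = cinner (J x) (J ((R ^^ k) (R y)))" by (rule Suc)
    finally show ?case by (simp add: funpow_swap1)
  qed simp
  have dbl: "(norm (J ((R ^^ k) x)))\<^sup>2 \<le> norm (J x) * norm (J ((R ^^ (2 * k)) x))" for k x
  proof -
    have "(norm (J ((R ^^ k) x)))\<^sup>2 = Re (cinner (J x) (J ((R ^^ (2 * k)) x)))"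
      using sym[of k x "(R ^^ k) x"] by (simp add: Re_cinner_self[symmetric] mult_2 funpow_add)
    also have "\<dots> \<le> norm (J x) * norm (J ((R ^^ (2 * k)) x))" by (rule Re_cinner_le)
    finally show ?thesis .
  qed
  have Rn: "norm ((R ^^ k) x) \<le> norm x * B ^ k" for k x
  proof (induction k)
    case (Suc k)
    have "norm ((R ^^ Suc k) x) \<le> norm ((R ^^ k) x) * B" using B(2) by simp
    also have "\<dots> \<le> norm x * B ^ k * B" using Suc B(1) by (intro mult_right_mono) auto
    finally show ?case by (simp add: mult_ac)
  qed simp
  have Jn: "norm (J x) \<le> sqrt a * norm x" for x
  proof (rule power2_le_imp_le)
    have "(norm (J x))\<^sup>2 = Re (cinner (A x) x)"
      by (simp add: Re_cinner_self[symmetric] hilbert_completionD(3)[OF J] A_inner_def)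
    also have "\<dots> \<le> norm (A x) * norm x" by (rule Re_cinner_le)
    also have "\<dots> \<le> norm x * a * norm x" by (intro mult_right_mono a) auto
    also have "\<dots> = (sqrt a * norm x)\<^sup>2"
      using a(1) by (simp add: power_mult_distrib) (simp add: power2_eq_square)
    finally show "(norm (J x))\<^sup>2 \<le> (sqrt a * norm x)\<^sup>2" .
  qed (use a in simp)
  \<comment> \<open>Were the quotient \<open>q\<close> above 1, repeated squaring would make
    \<open>q ^ (2 ^ k)\<close> exceed \<open>sqrt a * norm x\<close>, a bound independent of
    \<open>k\<close>.\<close>
  have unit: "norm (J (R x)) \<le> B" if x: "norm (J x) = 1" for x
  proof (rule ccontr)
    assume neg: "\<not> ?thesis"
    define q where "q = norm (J (R x)) / B"
    have q: "q > 1" using neg B(1) by (simp add: q_def)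
    have pw: "norm (J (R x)) ^ (2 ^ k) \<le> norm (J ((R ^^ (2 ^ k)) x))" for k
    proof (induction k)
      case (Suc k)
      have "norm (J (R x)) ^ (2 ^ Suc k) = (norm (J (R x)) ^ (2 ^ k))\<^sup>2"
        by (simp add: power_mult[symmetric] mult.commute)
      also have "\<dots> \<le> (norm (J ((R ^^ (2 ^ k)) x)))\<^sup>2"
        using Suc by (intro power_mono) auto
      also have "\<dots> \<le> norm (J ((R ^^ (2 ^ Suc k)) x))"
        using dbl[of "2 ^ k" x] x by simp
      finally show ?case .
    qed simp
    have bdd: "q ^ (2 ^ k) \<le> sqrt a * norm x" for k
    proof -
      have "norm (J (R x)) ^ (2 ^ k) \<le> sqrt a * norm ((R ^^ (2 ^ k)) x)"
        by (rule order_trans[OF pw Jn])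
      also have "\<dots> \<le> sqrt a * (norm x * B ^ (2 ^ k))"
        using a(1) by (intro mult_left_mono Rn) auto
      finally show ?thesis using B(1) by (simp add: q_def power_divide divide_le_eq mult.assoc)
    qed
    obtain k where k: "sqrt a * norm x < q ^ k"
      using real_arch_pow[OF q] by blast
    have "q ^ k \<le> q ^ (2 ^ k)"
      using q by (intro power_increasing less_imp_le[OF less_exp]) simp
    then show False using k bdd[of k] by linarith
  qed
  \<comment> \<open>The additional factor \<open>norm (J x)\<close> makes the case of seminorm 0
    trivial and is what the final Cauchy-Schwarz step produces.\<close>
  have RB: "norm (J (R x)) * norm (J x) \<le> B * (norm (J x))\<^sup>2" for x
  proof (cases "norm (J x) = 0")
    case False
    define c where "c = complex_of_real (inverse (norm (J x)))"
    have c: "cmod c = inverse (norm (J x))" by (simp add: c_def norm_inverse)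
    have "norm (J (c *\<^sub>C x)) = 1"
      using False by (simp add: hilbert_completionD(2)[OF J] norm_scaleC c)
    then have "norm (J (R (c *\<^sub>C x))) \<le> B" by (rule unit)
    then have "inverse (norm (J x)) * norm (J (R x)) \<le> B"
      by (simp add: hilbert_completionD(2)[OF J] norm_scaleC c bounded_clinear_scaleC[OF R])
    moreover have "0 < norm (J x)" using False by simp
    ultimately have "norm (J (R x)) \<le> B * norm (J x)" by (simp add: field_simps)
    then have "norm (J (R x)) * norm (J x) \<le> B * norm (J x) * norm (J x)"
      by (rule mult_right_mono) simp
    then show ?thesis by (simp add: power2_eq_square mult.assoc)
  qed simp
  have "norm (J (T x)) \<le> sqrt B * norm (J x)" for x
  proof (rule power2_le_imp_le)
    have "(norm (J (T x)))\<^sup>2 = Re (cinner (J (R x)) (J x))"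
      by (simp add: Re_cinner_self[symmetric] JT)
    also have "\<dots> \<le> norm (J (R x)) * norm (J x)" by (rule Re_cinner_le)
    also have "\<dots> \<le> B * (norm (J x))\<^sup>2" by (rule RB)
    finally show "(norm (J (T x)))\<^sup>2 \<le> (sqrt B * norm (J x))\<^sup>2"
      using B(1) by (simp add: power_mult_distrib)
  qed (use B(1) in simp)
  then show ?thesis using B(1) by (intro exI[of _ "sqrt B"]) auto
qed

text \<open>Extension by continuity from \<open>range J\<close> to its closure, which shows that the
  choice in \<open>induced_op\<close> has a witness.\<close>

lemma induced_op:
  assumes J: "hilbert_completion A J"
    and S: "\<And>x y. S (x + y) = S x + S y" "\<And>c x. S (c *\<^sub>C x) = c *\<^sub>C S x"
    and C: "C \<ge> 0" "\<And>x. norm (J (S x)) \<le> C * norm (J x)"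
  shows "bounded_op_on (closure (range J)) (induced_op J S)" "induced_op J S (J x) = J (S x)"
proof -
  define K where "K = closure (range J)"
  interpret K: closed_csubspace K
    unfolding K_def by (rule closed_csubspace_completion[OF J])
  have "S (x - y) = S x - S y" for x y
    using S(1)[of x "(-1) *\<^sub>C y"] S(2)[of "-1" y] by (simp add: scaleC_minus_one)
  then have lip: "norm (J (S x) - J (S y)) \<le> C * norm (J x - J y)" for x y
    using C(2)[of "x - y"] by (simp add: hilbert_completion_diff[OF J])
  \<comment> \<open>The limit is common to all sequences representing \<open>k\<close>. Constant
    sequences show in particular that \<open>J (S x)\<close> depends on \<open>J x\<close>
    alone.\<close>
  have ex: "\<exists>l. \<forall>a. (\<lambda>n. J (a n)) \<longlonglongrightarrow> k \<longrightarrow> (\<lambda>n. J (S (a n))) \<longlonglongrightarrow> l" if k: "k \<in> K" for k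
  proof -
    obtain b where b: "(\<lambda>n. J (b n)) \<longlonglongrightarrow> k"
      using k unfolding K_def by (rule closure_range_sequence)
    have "Cauchy (\<lambda>n. J (S (b n)))"
    proof (rule metric_CauchyI)
      fix e :: real assume e: "e > 0"
      then have "e / (C + 1) > 0" using C(1) by simp
      then obtain M where M: "\<And>m n. m \<ge> M \<Longrightarrow> n \<ge> M \<Longrightarrow> norm (J (b m) - J (b n)) < e / (C + 1)"
        using LIMSEQ_imp_Cauchy[OF b] unfolding Cauchy_def dist_norm by metis
      have "norm (J (S (b m)) - J (S (b n))) < e" if "m \<ge> M" "n \<ge> M" for m n
      proof -
        have "norm (J (S (b m)) - J (S (b n))) \<le> C * (e / (C + 1))"
          using order_trans[OF lip mult_left_mono[OF less_imp_le[OF M[OF that]] C(1)]] .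
        also have "\<dots> < e" using e C(1) by (simp add: field_simps)
        finally show ?thesis .
      qed
      then show "\<exists>M. \<forall>m\<ge>M. \<forall>n\<ge>M. dist (J (S (b m))) (J (S (b n))) < e"
        unfolding dist_norm by blast
    qed
    then obtain l where l: "(\<lambda>n. J (S (b n))) \<longlonglongrightarrow> l"
      using Cauchy_convergent_iff convergent_def by blast
    have "(\<lambda>n. J (S (a n))) \<longlonglongrightarrow> l" if a: "(\<lambda>n. J (a n)) \<longlonglongrightarrow> k" for a
    proof -
      have "(\<lambda>n. J (a n) - J (b n)) \<longlonglongrightarrow> 0"
        using tendsto_diff[OF a b] by simp
      then have "(\<lambda>n. C * norm (J (a n) - J (b n))) \<longlonglongrightarrow> 0"
        by (intro tendsto_mult_right_zero tendsto_norm_zero)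
      then have "(\<lambda>n. J (S (a n)) - J (S (b n))) \<longlonglongrightarrow> 0"
        by (rule Lim_null_comparison[rotated]) (simp add: lip)
      from tendsto_add[OF this l] show ?thesis by simp
    qed
    then show ?thesis by blast
  qed
  then obtain T where T: "\<And>k a. k \<in> K \<Longrightarrow> (\<lambda>n. J (a n)) \<longlonglongrightarrow> k \<Longrightarrow> (\<lambda>n. J (S (a n))) \<longlonglongrightarrow> T k"
    by metis
  have seq: "\<exists>a. (\<lambda>n. J (a n)) \<longlonglongrightarrow> k" if "k \<in> K" for k
    using that closure_range_sequence unfolding K_def by metis
  have "bounded_op_on K T"
  proof (rule bounded_op_onI[where M = C])
    fix u assume u: "u \<in> K"
    then obtain a where a: "(\<lambda>n. J (a n)) \<longlonglongrightarrow> u" using seq by blast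
    have "J (S (a n)) \<in> K" for n
      unfolding K_def by (rule subsetD[OF closure_subset]) simp
    then show "T u \<in> K" using closed_sequentially[OF K.clo _ T[OF u a]] by blast
    show "T (c *\<^sub>C u) = c *\<^sub>C T u" for c
    proof (rule LIMSEQ_unique)
      show "(\<lambda>n. J (S (c *\<^sub>C a n))) \<longlonglongrightarrow> T (c *\<^sub>C u)"
        using bounded_linear.tendsto[OF bounded_linear_scaleC a, of c]
        by (intro T K.scaleC_in u) (simp add: hilbert_completionD(2)[OF J])
      show "(\<lambda>n. J (S (c *\<^sub>C a n))) \<longlonglongrightarrow> c *\<^sub>C T u"
        using bounded_linear.tendsto[OF bounded_linear_scaleC T[OF u a], of c]
        by (simp add: S(2) hilbert_completionD(2)[OF J])
    qed
    show "norm (T u) \<le> C * norm u"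
    proof (rule LIMSEQ_le)
      show "(\<lambda>n. norm (J (S (a n)))) \<longlonglongrightarrow> norm (T u)" by (rule tendsto_norm[OF T[OF u a]])
      show "(\<lambda>n. C * norm (J (a n))) \<longlonglongrightarrow> C * norm u"
        by (rule tendsto_mult_left[OF tendsto_norm[OF a]])
      show "\<exists>N. \<forall>n\<ge>N. norm (J (S (a n))) \<le> C * norm (J (a n))" using C(2) by blast
    qed
    fix v assume v: "v \<in> K"
    then obtain b where b: "(\<lambda>n. J (b n)) \<longlonglongrightarrow> v" using seq by blast
    show "T (u + v) = T u + T v"
    proof (rule LIMSEQ_unique)
      show "(\<lambda>n. J (S (a n + b n))) \<longlonglongrightarrow> T (u + v)"
        using tendsto_add[OF a b] by (intro T K.add_in u v) (simp add: hilbert_completionD(1)[OF J])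
      show "(\<lambda>n. J (S (a n + b n))) \<longlonglongrightarrow> T u + T v"
        using tendsto_add[OF T[OF u a] T[OF v b]] by (simp add: S(1) hilbert_completionD(1)[OF J])
    qed
  qed
  moreover have "T (J x) = J (S x)" for x
  proof -
    have "J x \<in> K" unfolding K_def by (rule subsetD[OF closure_subset]) simp
    from T[OF this tendsto_const] show ?thesis by (simp add: LIMSEQ_const_iff)
  qed
  ultimately have "\<exists>T. bounded_op_on (closure (range J)) T \<and> (\<forall>x. T (J x) = J (S x))"
    unfolding K_def by blast
  from someI_ex[OF this]
  show "bounded_op_on (closure (range J)) (induced_op J S)" "induced_op J S (J x) = J (S x)"
    unfolding induced_op_def by blast+
qed

text \<open>On \<open>range J\<close> the form is \<open>cinner (J (U x)) (J (U y))\<close>, visibly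
  symmetric and nonnegative, and both properties pass to the closure. Taking \<open>U\<close> to be
  an operator or its \<open>A\<close>-adjoint covers products in either order.\<close>

lemma psd_on_induced_op:
  assumes J: "hilbert_completion A J" and A: "bounded_clinear A"
    and U: "bounded_clinear U" and V: "bounded_clinear V"
    and adj: "\<And>x y. A_inner A (U x) y = A_inner A x (V y)"
  shows "psd_on (closure (range J)) (induced_op J (V \<circ> U))"
    and "cinner (induced_op J (V \<circ> U) (J x)) (J x) = of_real ((norm (J (U x)))\<^sup>2)"
proof -
  define K where "K = closure (range J)"
  define T where "T = induced_op J (V \<circ> U)"
  interpret K: closed_csubspace K
    unfolding K_def by (rule closed_csubspace_completion[OF J])
  have adj': "A_inner A (V x) y = A_inner A x (U y)" for x y
    using adj[of y x] A_inner_commute[OF J, of "V x" y] A_inner_commute[OF J, of x "U y"] by simp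
  obtain C where C: "C \<ge> 0" "\<And>x. norm (J (U x)) \<le> C * norm (J x)"
    using A_adjoint_imp_A_bounded[OF J A U V adj] by blast
  obtain D where D: "D \<ge> 0" "\<And>x. norm (J (V x)) \<le> D * norm (J x)"
    using A_adjoint_imp_A_bounded[OF J A V U adj'] by blast
  have VU: "bounded_clinear (V \<circ> U)" by (rule bounded_clinear_comp[OF V U])
  have bd: "norm (J ((V \<circ> U) x)) \<le> (D * C) * norm (J x)" for x
  proof -
    have "norm (J (V (U x))) \<le> D * (C * norm (J x))"
      by (rule order_trans[OF D(2)[of "U x"] mult_left_mono[OF C(2)[of x] D(1)]])
    then show ?thesis by (simp add: mult.assoc)
  qed
  note ind = induced_op[where S = "V \<circ> U" and C = "D * C", OF J bounded_clinear_add[OF VU]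
      bounded_clinear_scaleC[OF VU] mult_nonneg_nonneg[OF D(1) C(1)] bd]
  have bT: "bounded_op_on K T"
    unfolding K_def T_def by (rule ind(1))
  have TJ: "T (J x) = J (V (U x))" for x
    using ind(2)[of x] by (simp add: T_def)
  have form: "cinner (T (J x)) (J y) = cinner (J (U x)) (J (U y))"
    "cinner (J x) (T (J y)) = cinner (J (U x)) (J (U y))" for x y
    by (simp_all add: TJ hilbert_completionD(3)[OF J] adj' adj)
  have seq: "\<exists>a. (\<lambda>n. J (a n)) \<longlonglongrightarrow> k" if "k \<in> K" for k
    using that closure_range_sequence unfolding K_def by metis
  have JK: "J x \<in> K" for x
    unfolding K_def by (rule subsetD[OF closure_subset]) simp
  have Tlim: "(\<lambda>n. T (J (a n))) \<longlonglongrightarrow> T k" if "(\<lambda>n. J (a n)) \<longlonglongrightarrow> k" "k \<in> K" for a k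
    using K.bounded_op_on_tendsto[OF bT JK that] .
  have "psd_on K T"
    unfolding psd_on_def
  proof (intro conjI ballI bT)
    fix u v assume u: "u \<in> K" and v: "v \<in> K"
    obtain a b where a: "(\<lambda>n. J (a n)) \<longlonglongrightarrow> u" and b: "(\<lambda>n. J (b n)) \<longlonglongrightarrow> v"
      using seq[OF u] seq[OF v] by blast
    have "(\<lambda>n. cinner (T (J (a n))) (J (b n))) \<longlonglongrightarrow> cinner (T u) v"
      by (intro tendsto_cinner Tlim a b u)
    moreover have "(\<lambda>n. cinner (J (a n)) (T (J (b n)))) \<longlonglongrightarrow> cinner u (T v)"
      by (intro tendsto_cinner Tlim a b v)
    ultimately show "cinner (T u) v = cinner u (T v)"
      unfolding form by (rule LIMSEQ_unique)
  next
    fix u assume u: "u \<in> K"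
    obtain a where a: "(\<lambda>n. J (a n)) \<longlonglongrightarrow> u" using seq[OF u] by blast
    have "(\<lambda>n. Re (cinner (T (J (a n))) (J (a n)))) \<longlonglongrightarrow> Re (cinner (T u) u)"
      by (intro tendsto_Re tendsto_cinner Tlim a u)
    then show "0 \<le> Re (cinner (T u) u)"
      by (rule LIMSEQ_le_const) (simp add: form Re_cinner_self)
  qed
  then show "psd_on (closure (range J)) (induced_op J (V \<circ> U))"
    by (simp add: K_def T_def)
  show "cinner (induced_op J (V \<circ> U) (J x)) (J x) = of_real ((norm (J (U x)))\<^sup>2)"
    using form(1)[of x x] by (simp only: T_def cinner_self)
qed

text \<open>The vector \<open>x\<close> is not normalized and the tangent points are free, so that
  the inequalities for the two components of a block vector can be added with common tangent
  points.\<close>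

lemma power_sum_norm_above_tangent:
  assumes J: "hilbert_completion A J" and A: "bounded_clinear A"
    and ops: "bounded_clinear U" "bounded_clinear V" "bounded_clinear U'" "bounded_clinear V'"
    and adj: "\<And>x y. A_inner A (U x) y = A_inner A x (V y)"
    and adj': "\<And>x y. A_inner A (U' x) y = A_inner A x (V' y)"
    and r: "r \<ge> 1" and s: "s \<ge> 0" "s' \<ge> 0"
  shows "(s powr r + s' powr r) * (norm (J x))\<^sup>2
      + r * s powr (r - 1) * ((norm (J (U x)))\<^sup>2 - s * (norm (J x))\<^sup>2)
      + r * s' powr (r - 1) * ((norm (J (U' x)))\<^sup>2 - s' * (norm (J x))\<^sup>2)
    \<le> power_sum_norm J r (V \<circ> U) (V' \<circ> U') * (norm (J x))\<^sup>2"
proof -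
  define K where "K = closure (range J)"
  interpret K: closed_csubspace K
    unfolding K_def by (rule closed_csubspace_completion[OF J])
  have JK: "J x \<in> K"
    unfolding K_def by (rule subsetD[OF closure_subset]) simp
  define T T' where "T = induced_op J (V \<circ> U)" and "T' = induced_op J (V' \<circ> U')"
  have T: "psd_on K T" "Re (cinner (T (J x)) (J x)) = (norm (J (U x)))\<^sup>2"
    and T': "psd_on K T'" "Re (cinner (T' (J x)) (J x)) = (norm (J (U' x)))\<^sup>2"
    unfolding T_def T'_def K_def
    using psd_on_induced_op[OF J A ops(1,2) adj] psd_on_induced_op[OF J A ops(3,4) adj'] by simp_all
  define P where "P y = rpower_on K T r y + rpower_on K T' r y" for y
  have "bounded_op_on K (rpower_on K Q r)" if Q: "psd_on K Q" for Q
  proof -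
    have "bounded_op_on K Q" using Q by (simp add: psd_on_def)
    then obtain L where "\<And>x. x \<in> K \<Longrightarrow> norm (Q x) \<le> L * norm x"
      using bounded_op_on_pos_bound by metis
    then show ?thesis by (rule K.rpower_on_approx(1)[OF Q r])
  qed
  then have "bounded_op_on K P"
    unfolding P_def using T(1) T'(1) by (intro K.bounded_op_on_plus)
  have "Re (cinner (P (J x)) (J x)) \<le> norm (P (J x)) * norm (J x)" by (rule Re_cinner_le)
  also have "\<dots> \<le> onorm_on K P * norm (J x) * norm (J x)"
    by (intro mult_right_mono K.norm_le_onorm_on[OF \<open>bounded_op_on K P\<close> JK]) simp
  also have "onorm_on K P = power_sum_norm J r (V \<circ> U) (V' \<circ> U')"
    unfolding power_sum_norm_def Let_def P_def T_def T'_def K_def ..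
  finally have "Re (cinner (P (J x)) (J x)) \<le> power_sum_norm J r (V \<circ> U) (V' \<circ> U') * (norm (J x))\<^sup>2"
    by (simp add: power2_eq_square mult.assoc)
  moreover have "Re (cinner (P (J x)) (J x)) =
      Re (cinner (rpower_on K T r (J x)) (J x)) + Re (cinner (rpower_on K T' r (J x)) (J x))"
    by (simp add: P_def cinner_add_left)
  moreover note K.rpower_on_above_tangent[OF T(1) r s(1) JK, unfolded T(2)]
    K.rpower_on_above_tangent[OF T'(1) r s(2) JK, unfolded T'(2)]
  ultimately show ?thesis by (simp add: algebra_simps)
qed

text \<open>The bound \<open>C\<close> keeps the set under \<open>Sup\<close> bounded above, and
  homogeneity carries the estimate from unit vectors to all others. The inserted 0 gives
  nonnegativity.\<close>

lemma cmod_A_inner_le_numerical_radius: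
  assumes J: "hilbert_completion A J" and S: "\<And>c x. S (c *\<^sub>C x) = c *\<^sub>C S x"
    and C: "\<And>x. norm (J (S x)) \<le> C * norm (J x)"
  shows "cmod (A_inner A (S x) x) \<le> \<omega> A S * (norm (J x))\<^sup>2" and "0 \<le> \<omega> A S"
proof -
  let ?W = "insert 0 {cmod (A_inner A (S x) x) |x. A_norm A x = 1}"
  have le: "cmod (A_inner A (S x) x) \<le> norm (J (S x)) * norm (J x)" for x
    using cmod_cinner_le[of "J (S x)" "J x"] by (simp add: hilbert_completionD(3)[OF J])
  have "bdd_above ?W"
  proof (rule bdd_aboveI)
    fix w assume "w \<in> ?W"
    then consider "w = 0" | y where "w = cmod (A_inner A (S y) y)" "norm (J y) = 1"
      using A_norm_eq_norm[OF J] by auto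
    then show "w \<le> max 0 C"
    proof cases
      case 2
      then show ?thesis using le[of y] C[of y] by simp
    qed simp
  qed
  then have upper: "w \<le> \<omega> A S" if "w \<in> ?W" for w
    unfolding A_numerical_radius_def using that by (rule cSup_upper[rotated])
  then show "0 \<le> \<omega> A S" by simp
  show "cmod (A_inner A (S x) x) \<le> \<omega> A S * (norm (J x))\<^sup>2"
  proof (cases "norm (J x) = 0")
    case True
    then show ?thesis using le[of x] by simp
  next
    case False
    define n where "n = norm (J x)"
    have n: "n > 0" using False by (simp add: n_def)
    define y where "y = complex_of_real (inverse n) *\<^sub>C x"
    have "norm (J y) = 1"
      using n by (simp add: y_def hilbert_completionD(2)[OF J] norm_scaleC n_def[symmetric] norm_inverse)
    then have "cmod (A_inner A (S y) y) \<le> \<omega> A S"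
      using A_norm_eq_norm[OF J] by (intro upper) auto
    moreover have "A_inner A (S y) y = of_real (inverse n * inverse n) * A_inner A (S x) x"
      by (simp add: y_def S hilbert_completionD(2)[OF J] hilbert_completionD(3)[OF J, symmetric] cinner_simps)
    then have "cmod (A_inner A (S y) y) = inverse n * inverse n * cmod (A_inner A (S x) x)"
      using n by (simp add: norm_mult norm_inverse)
    ultimately show ?thesis
      using n by (simp add: n_def[symmetric] field_simps power2_eq_square)
  qed
qed


section \<open>The numerical radius inequality\<close>

text \<open>With \<open>M \<le> (P + W) / 2\<close> weighted by 1 / (\<beta> + 1) and
  \<open>M \<le> P\<close> by \<beta> / (\<beta> + 1), the coefficient of \<open>P\<close> is the
  sum 1 / (2(\<beta> + 1)) + \<beta> / (\<beta> + 1).\<close>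

lemma powr_convex_mix:
  fixes m a w r \<beta> :: real
  assumes "m \<ge> 0" "a \<ge> 0" "w \<ge> 0" "\<beta> \<ge> 0" "r \<ge> 1"
    and m1: "m\<^sup>2 \<le> (a + w) / 2" and m2: "m\<^sup>2 \<le> a"
  shows "m powr (4 * r) \<le> (2 * \<beta> + 1) / (2 * (\<beta> + 1)) * a powr (2 * r)
    + 1 / (2 * (\<beta> + 1)) * w powr (2 * r)"
proof -
  define P W M where "P = a powr (2 * r)" and "W = w powr (2 * r)" and "M = m powr (4 * r)"
  have "M = (m\<^sup>2) powr (2 * r)"
    using assms(1) by (simp add: M_def power2_eq_square powr_mult powr_add[symmetric])
  moreover have "(m\<^sup>2) powr (2 * r) \<le> ((a + w) / 2) powr (2 * r)"
    using m1 assms by (intro powr_mono2) auto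
  moreover have "((a + w) / 2) powr (2 * r) \<le> (P + W) / 2"
    unfolding P_def W_def using assms by (intro powr_midpoint_le) auto
  moreover have "(m\<^sup>2) powr (2 * r) \<le> P"
    unfolding P_def using m2 assms by (intro powr_mono2) auto
  ultimately have 1: "M \<le> (P + W) / 2" and 2: "M \<le> P" by linarith+
  have "\<beta> * M \<le> \<beta> * P" using 2 assms(4) by (rule mult_left_mono)
  then have "2 * (\<beta> + 1) * M \<le> (2 * \<beta> + 1) * P + W"
    using 1 by (simp add: algebra_simps)
  then have "M \<le> ((2 * \<beta> + 1) * P + W) / (2 * (\<beta> + 1))"
    using assms(4) by (simp add: pos_le_divide_eq mult.commute)
  also have "\<dots> = (2 * \<beta> + 1) / (2 * (\<beta> + 1)) * P + 1 / (2 * (\<beta> + 1)) * W"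
    by (simp only: add_divide_distrib[of "_ * P"] times_divide_eq_left mult_1_left)
  finally show ?thesis
    by (simp only: P_def W_def M_def)
qed

lemma block_quadratic_form_bound:
  fixes A X Y :: "'h::complex_hilbert_space \<Rightarrow> 'h"
    and J :: "'h \<Rightarrow> 'k::complex_hilbert_space"
  assumes A: "positive_op A" and J: "hilbert_completion A J"
    and X: "X \<in> A_bounded_ops A" and Y: "Y \<in> A_bounded_ops A"
    and \<beta>: "\<beta> \<ge> 0" and r: "r \<ge> 1"
    and unit: "(norm (J x))\<^sup>2 + (norm (J y))\<^sup>2 = 1"
  shows "cmod (A_inner A (X y) x + A_inner A (Y x) y) powr (4 * r)
    \<le> (2 * \<beta> + 1) / (8 * (\<beta> + 1)) *
        max ((power_sum_norm J r (A_sharp A Y \<circ> Y) (X \<circ> A_sharp A X))\<^sup>2)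
            ((power_sum_norm J r (Y \<circ> A_sharp A Y) (A_sharp A X \<circ> X))\<^sup>2)
      + 1 / (2 * (\<beta> + 1)) *
        max (\<omega> A (X \<circ> Y) powr (2 * r)) (\<omega> A (Y \<circ> X) powr (2 * r))"
proof -
  define X' Y' where "X' = A_sharp A X" and "Y' = A_sharp A Y"
  have bA: "bounded_clinear A" using A by (simp add: positive_op_def)
  have bX: "bounded_clinear X" and bY: "bounded_clinear Y"
    using X Y unfolding A_bounded_ops_def by blast+
  have bX': "bounded_clinear X'" and bY': "bounded_clinear Y'"
    unfolding X'_def Y'_def by (rule A_sharp(1)[OF A X], rule A_sharp(1)[OF A Y])
  have aX: "A_inner A (X u) v = A_inner A u (X' v)" for u v
    unfolding X'_def by (rule A_sharp(2)[OF A X])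
  have aY: "A_inner A (Y u) v = A_inner A u (Y' v)" for u v
    unfolding Y'_def by (rule A_sharp(2)[OF A Y])
  have aX': "A_inner A (X' u) v = A_inner A u (X v)" for u v
    using aX[of v u] A_inner_commute[OF J, of "X' u" v] A_inner_commute[OF J, of u "X v"] by simp
  have aY': "A_inner A (Y' u) v = A_inner A u (Y v)" for u v
    using aY[of v u] A_inner_commute[OF J, of "Y' u" v] A_inner_commute[OF J, of u "Y v"] by simp
  obtain CX CY where CX: "CX \<ge> 0" "\<And>x. norm (J (X x)) \<le> CX * norm (J x)"
    and CY: "CY \<ge> 0" "\<And>x. norm (J (Y x)) \<le> CY * norm (J x)"
    using A_adjoint_imp_A_bounded[OF J bA bX bX' aX] A_adjoint_imp_A_bounded[OF J bA bY bY' aY] by blast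

  \<comment> \<open>\<open>u\<close> and \<open>v\<close> are the images of \<open>h\<close> under
    the block operator and its adjoint, whose off-diagonal entries are \<open>Y'\<close> and
    \<open>X'\<close>; therefore \<open>cinner u v\<close> is the form of the squared block
    operator.\<close>
  define h where "h = (J x, J y)"
  define u where "u = (J (X y), J (Y x))"
  define v where "v = (J (Y' y), J (X' x))"
  define m where "m = cmod (A_inner A (X y) x + A_inner A (Y x) y)"
  define s s' where "s = (norm u)\<^sup>2" and "s' = (norm v)\<^sup>2"
  have uh: "cinner u h = A_inner A (X y) x + A_inner A (Y x) y"
    by (simp add: u_def h_def cinner_prod_def hilbert_completionD(3)[OF J])
  have hv: "cinner h v = A_inner A (X y) x + A_inner A (Y x) y"
    by (simp add: v_def h_def cinner_prod_def hilbert_completionD(3)[OF J] aX aY)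
  have uv: "cinner u v = A_inner A ((X \<circ> Y) x) x + A_inner A ((Y \<circ> X) y) y"
    by (simp add: u_def v_def cinner_prod_def hilbert_completionD(3)[OF J] aX aY add.commute)
  have nh: "norm h = 1" using unit by (simp add: h_def norm_prod_def)
  have s: "s = (norm (J (Y x)))\<^sup>2 + (norm (J (X y)))\<^sup>2"
    by (simp add: s_def u_def norm_prod_def)
  have s': "s' = (norm (J (X' x)))\<^sup>2 + (norm (J (Y' y)))\<^sup>2"
    by (simp add: s'_def v_def norm_prod_def)
  define a w where "a = norm u * norm v" and "w = cmod (cinner u v)"
  have "m\<^sup>2 = cmod (cinner u h * cinner h v)"
    by (simp add: m_def uh hv norm_mult power2_eq_square)
  then have m1: "m\<^sup>2 \<le> (a + w) / 2"
    using Buzano[OF nh, of u v] by (simp add: a_def w_def)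
  have "m \<le> norm u" "m \<le> norm v"
    using cmod_cinner_le[of u h] cmod_cinner_le[of h v] by (simp_all add: m_def uh hv nh)
  then have m2: "m\<^sup>2 \<le> a"
    unfolding a_def power2_eq_square by (intro mult_mono) (auto simp: m_def)

  define l1 l2 where "l1 = power_sum_norm J r (Y' \<circ> Y) (X \<circ> X')"
    and "l2 = power_sum_norm J r (Y \<circ> Y') (X' \<circ> X)"
  define M where "M = max l1 l2"
  have s0: "s \<ge> 0" "s' \<ge> 0" by (simp_all add: s_def s'_def)
  \<comment> \<open>The tangent points are the squared norms \<open>s\<close> and \<open>s'\<close>.
    They are the sums of the quadratic forms over both components, so the linear terms vanish once
    the two inequalities are added and \<open>nx + ny = 1\<close> is used.\<close>
  define d d' where "d = r * s powr (r - 1)" and "d' = r * s' powr (r - 1)"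
  define nx ny where "nx = (norm (J x))\<^sup>2" and "ny = (norm (J y))\<^sup>2"
  have "(s powr r + s' powr r) * nx + d * ((norm (J (Y x)))\<^sup>2 - s * nx)
      + d' * ((norm (J (X' x)))\<^sup>2 - s' * nx) \<le> l1 * nx"
    unfolding d_def d'_def l1_def nx_def
    by (rule power_sum_norm_above_tangent[OF J bA bY bY' bX' bX aY aX' r s0])
  \<comment> \<open>The tangent points trade places: for \<open>y\<close> it is \<open>Y'\<close>
    that contributes to \<open>s'\<close> and \<open>X\<close> that contributes to
    \<open>s\<close>.\<close>
  moreover have "(s' powr r + s powr r) * ny + d' * ((norm (J (Y' y)))\<^sup>2 - s' * ny)
      + d * ((norm (J (X y)))\<^sup>2 - s * ny) \<le> l2 * ny"
    unfolding d_def d'_def l2_def ny_def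
    by (rule power_sum_norm_above_tangent[OF J bA bY' bY bX bX' aY' aX r s0(2,1)])
  moreover have "l1 * nx \<le> M * nx" "l2 * ny \<le> M * ny"
    by (auto simp: M_def nx_def ny_def intro!: mult_right_mono)
  ultimately have "(s powr r + s' powr r) * (nx + ny)
      + d * (((norm (J (Y x)))\<^sup>2 + (norm (J (X y)))\<^sup>2) - s * (nx + ny))
      + d' * (((norm (J (X' x)))\<^sup>2 + (norm (J (Y' y)))\<^sup>2) - s' * (nx + ny)) \<le> M * (nx + ny)"
    by (simp add: algebra_simps)
  moreover have "nx + ny = 1" using unit by (simp add: nx_def ny_def)
  ultimately have sM: "s powr r + s' powr r \<le> M"
    by (simp add: s[symmetric] s'[symmetric])
  \<comment> \<open>From here the arithmetic-geometric mean inequality for \<open>s powr r\<close>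
    and \<open>s' powr r\<close> yields the factor 1/4.\<close>
  have "a powr (2 * r) = (a * a) powr r"
    using powr_add[of a r r] powr_mult[of a a r] by (simp add: a_def)
  also have "a * a = s * s'"
    by (simp add: a_def s_def s'_def power2_eq_square)
  also have "(s * s') powr r = s powr r * s' powr r"
    using s0 by (simp add: powr_mult)
  also have "\<dots> \<le> ((s powr r + s' powr r) / 2)\<^sup>2"
    using sum_squares_ge_zero[of "s powr r - s' powr r" 0] by (simp add: power2_eq_square field_simps)
  also have "\<dots> \<le> (M / 2)\<^sup>2"
    using sM by (intro power_mono divide_right_mono) auto
  also have "\<dots> = M\<^sup>2 / 4" by (simp add: power2_eq_square)
  also have "M\<^sup>2 \<le> max (l1\<^sup>2) (l2\<^sup>2)" by (auto simp: M_def max_def)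
  finally have aM: "a powr (2 * r) \<le> max (l1\<^sup>2) (l2\<^sup>2) / 4" by simp

  define W where "W = max (\<omega> A (X \<circ> Y)) (\<omega> A (Y \<circ> X))"
  have bXY: "norm (J ((X \<circ> Y) z)) \<le> CX * CY * norm (J z)" for z
    using order_trans[OF CX(2)[of "Y z"] mult_left_mono[OF CY(2)[of z] CX(1)]] by (simp add: mult.assoc)
  have bYX: "norm (J ((Y \<circ> X) z)) \<le> CY * CX * norm (J z)" for z
    using order_trans[OF CY(2)[of "X z"] mult_left_mono[OF CX(2)[of z] CY(1)]] by (simp add: mult.assoc)
  note wXY = cmod_A_inner_le_numerical_radius[where S = "X \<circ> Y" and C = "CX * CY",
      OF J bounded_clinear_scaleC[OF bounded_clinear_comp[OF bX bY]] bXY]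
  note wYX = cmod_A_inner_le_numerical_radius[where S = "Y \<circ> X" and C = "CY * CX",
      OF J bounded_clinear_scaleC[OF bounded_clinear_comp[OF bY bX]] bYX]
  have "w \<le> cmod (A_inner A ((X \<circ> Y) x) x) + cmod (A_inner A ((Y \<circ> X) y) y)"
    unfolding w_def uv by (rule norm_triangle_ineq)
  also have "\<dots> \<le> \<omega> A (X \<circ> Y) * nx + \<omega> A (Y \<circ> X) * ny"
    unfolding nx_def ny_def by (intro add_mono wXY(1) wYX(1))
  also have "\<dots> \<le> W * nx + W * ny"
    by (intro add_mono mult_right_mono) (auto simp: W_def nx_def ny_def)
  also have "\<dots> = W" using \<open>nx + ny = 1\<close> by (simp flip: distrib_left)
  finally have "w powr (2 * r) \<le> W powr (2 * r)"
    using r by (intro powr_mono2) (auto simp: w_def)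
  also have "\<dots> \<le> max (\<omega> A (X \<circ> Y) powr (2 * r)) (\<omega> A (Y \<circ> X) powr (2 * r))"
    by (auto simp: W_def max_def)
  finally have wW: "w powr (2 * r) \<le> max (\<omega> A (X \<circ> Y) powr (2 * r)) (\<omega> A (Y \<circ> X) powr (2 * r))" .

  have "m powr (4 * r) \<le> (2 * \<beta> + 1) / (2 * (\<beta> + 1)) * a powr (2 * r) + 1 / (2 * (\<beta> + 1)) * w powr (2 * r)"
    by (rule powr_convex_mix) (use \<beta> r m1 m2 in \<open>auto simp: m_def a_def w_def\<close>)
  also have "\<dots> \<le> (2 * \<beta> + 1) / (2 * (\<beta> + 1)) * (max (l1\<^sup>2) (l2\<^sup>2) / 4)
      + 1 / (2 * (\<beta> + 1)) * max (\<omega> A (X \<circ> Y) powr (2 * r)) (\<omega> A (Y \<circ> X) powr (2 * r))"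
    using \<beta> by (intro add_mono mult_left_mono aM wW) auto
  finally show ?thesis
    unfolding m_def l1_def l2_def X'_def Y'_def by simp
qed

theorem theorem2p24:
  fixes A X Y :: "'h::complex_hilbert_space \<Rightarrow> 'h"
    and J :: "'h \<Rightarrow> 'k::complex_hilbert_space"
    and \<beta> r :: real
  assumes "positive_op A"
    and "hilbert_completion A J"
    and "X \<in> A_bounded_ops A" and "Y \<in> A_bounded_ops A"
    and "\<beta> \<ge> 0" and "r \<ge> 1"
  shows "\<omega> (block_op A (\<lambda>_. 0) (\<lambda>_. 0) A) (block_op (\<lambda>_. 0) X Y (\<lambda>_. 0)) powr (4 * r)
    \<le> (2 * \<beta> + 1) / (8 * (\<beta> + 1)) *
        max ((power_sum_norm J r (A_sharp A Y \<circ> Y) (X \<circ> A_sharp A X))\<^sup>2)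
            ((power_sum_norm J r (Y \<circ> A_sharp A Y) (A_sharp A X \<circ> X))\<^sup>2)
      + 1 / (2 * (\<beta> + 1)) *
        max (\<omega> A (X \<circ> Y) powr (2 * r)) (\<omega> A (Y \<circ> X) powr (2 * r))"
    (is "\<omega> ?A ?Z powr _ \<le> ?R")
proof -
  let ?W = "insert 0 {cmod (A_inner ?A (?Z z) z) |z. A_norm ?A z = 1}"
  \<comment> \<open>Bounding every member of the set by the root \<open>B\<close> of the right-hand
    side also shows the set bounded above, so that its supremum can be compared with the member
    0.\<close>
  define B where "B = ?R powr (1 / (4 * r))"
  have R0: "0 \<le> ?R"
    using assms(5) by (intro add_nonneg_nonneg mult_nonneg_nonneg) (auto simp: le_max_iff_disj)
  have le: "c \<le> B" if cW: "c \<in> ?W" for c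
  proof -
    consider "c = 0" | z where "c = cmod (A_inner ?A (?Z z) z)" "A_norm ?A z = 1"
      using cW by blast
    then show ?thesis
    proof cases
      case 2
      obtain x y where z: "z = (x, y)" by (cases z)
      have "(norm (J x))\<^sup>2 + (norm (J y))\<^sup>2 = Re (A_inner A x x + A_inner A y y)"
        by (simp flip: hilbert_completionD(3)[OF assms(2)] add: Re_cinner_self)
      also have "\<dots> = 1"
        using 2(2) by (simp add: z A_norm_def A_inner_def block_op_def cinner_prod_def)
      finally have "cmod (A_inner A (X y) x + A_inner A (Y x) y) powr (4 * r) \<le> ?R"
        by (rule block_quadratic_form_bound[OF assms])
      moreover have "c = cmod (A_inner A (X y) x + A_inner A (Y x) y)"
        using 2(1) bounded_clinear_zero[of A] assms(1)
        by (simp add: z A_inner_def block_op_def cinner_prod_def positive_op_def)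
      ultimately have "c powr (4 * r) \<le> ?R" by simp
      then have "(c powr (4 * r)) powr (1 / (4 * r)) \<le> B"
        unfolding B_def using assms(6) by (intro powr_mono2) auto
      moreover have "c \<ge> 0" using 2(1) by simp
      ultimately show ?thesis using assms(6) by (simp add: powr_powr)
    qed (simp add: B_def)
  qed
  have up: "\<omega> ?A ?Z \<le> B"
    unfolding A_numerical_radius_def by (rule cSup_least) (use le in auto)
  moreover have "0 \<le> \<omega> ?A ?Z"
    unfolding A_numerical_radius_def
    by (rule cSup_upper[OF insertI1 bdd_aboveI[OF le]])
  ultimately have "\<omega> ?A ?Z powr (4 * r) \<le> B powr (4 * r)"
    using assms(6) by (intro powr_mono2) auto
  also have "\<dots> = ?R"
    using R0 assms(6) by (simp add: B_def powr_powr)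
  finally show ?thesis .
qed

end
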